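(* Let $f:\mathbb{R}^d\to\mathbb{R}$ be continuously differentiable with Lipschitz continuous gradient with constant $L_1>0$, i.e. $\|\nabla f(z_1)-\nabla f(z_2)\|_*\le L_1\|z_1-z_2\|$ for all $z_1,z_2\in\mathbb{R}^d$. Let $\mathcal{Z}=\mathcal{X}\times\mathcal{Y}\subset\mathbb{R}^n\times\mathbb{R}^m$ be nonempty, compact and convex with diameter $D_z=\sup\{\|z_1-z_2\|:z_1,z_2\in\mathcal{Z}\}$. Let $\mu>0$ and let $\sigma\ge 0$ satisfy $E_u[\|G_\mu(z;u)-F_\mu(z)\|_*^2]\le\sigma^2$ for all $z\in\mathbb{R}^d$. Suppose that for some $\rho\in[0,\frac{1}{24L_1\kappa^2})$ there is $z^*\in\mathcal{Z}$ satisfying the proximal weak Minty variational inequality: for all $z,\bar z\in\mathcal{Z}$ and all $a>0$, $$\langle P_{\mathcal{Z}}(z,a,F(\bar z)),\bar z-z^*\rangle+\frac{\rho}{2}\|P_{\mathcal{Z}}(z,a,F(\bar z))\|_*^2\ge 0.$$ Let $\{z_k\}_{k\ge0}$, $\{\hat z_k\}_{k\ge0}$ be generated by the (projected) variance-reduced zeroth-order extragradient algorithm with sample sizes $t_k\in\mathbb{N}$, $t_k\ge1$, and $h_{1,k}=h_{2,k}=h$, where $h\in\left(\sqrt{\frac{6\rho}{L_1\kappa\overline{\lambda}\underline{\lambda}}},\frac{1}{2L_1\kappa\overline{\lambda}}\right]$, $h>0$, and let $s_k=P_{\mathcal{Z}}(z_k,h,G_k)$, where $G_k=\frac{1}{t_k}\sum_{i=1}^{t_k}G_\mu(z_k;\hat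 u_k^i)$ is the averaged oracle at $z_k$. Then for every number of iterations $N\ge0$, $$\frac{1}{N+1}\sum_{k=0}^{N}E_{\mathcal{U}_k}[|s_k|^2]\le\frac{2L_1\underline{\lambda}\overline{\lambda}\kappa|z_0-z^*|^2}{(L_1h^2\underline{\lambda}\overline{\lambda}\kappa-6\rho)(N+1)}+\frac{\mu D_z\underline{\lambda}\kappa L_1(d+3)^{3/2}}{L_1h^2\underline{\lambda}\overline{\lambda}\kappa-6\rho}+\frac{\mu^2\rho\underline{\lambda}\kappa^2L_1^2(d+3)^3}{L_1h^2\underline{\lambda}\overline{\lambda}\kappa-6\rho}$$ $$+\frac{(36\rho\kappa^2\underline{\lambda}+\frac{4\underline{\lambda}}{L_1})\sigma^2}{L_1h^2\underline{\lambda}\overline{\lambda}\kappa-6\rho}\cdot\frac{1}{N+1}\sum_{k=0}^{N}\frac{1}{t_k}+\frac{2D_z\underline{\lambda}\kappa\sigma}{L_1h^2\underline{\lambda}\overline{\lambda}\kappa-6\rho}\cdot\frac{1}{N+1}\sum_{k=0}^{N}\frac{1}{\sqrt{t_k}}.$$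
   Context: $n,m\in\mathbb{N}$, $d=n+m$, points $z=(x,y)\in\mathbb{R}^n\times\mathbb{R}^m=\mathbb{R}^d$. $B_1\in\mathbb{R}^{n\times n}$, $B_2\in\mathbb{R}^{m\times m}$ are symmetric positive definite, $B$ is the block-diagonal matrix with blocks $B_1,B_2$; $\underline{\lambda}$, $\overline{\lambda}$ are its smallest and largest eigenvalues and $\kappa=\overline{\lambda}/\underline{\lambda}$. $\langle\cdot,\cdot\rangle$ is the Euclidean inner product, $|z|=\langle z,z\rangle^{1/2}$, $\|z\|=\langle z,Bz\rangle^{1/2}$, $\|z\|_*=\langle z,B^{-1}z\rangle^{1/2}$. $F(z)=(\nabla_x f(z),-\nabla_y f(z))$. For $\mu>0$ the Gaussian smoothing of $f$ is $f_\mu(z)=E_u[f(z+\mu u)]$ with $u\sim\mathcal{N}(0,B^{-1})$, and $F_\mu(z)=(\nabla_x f_\mu(z),-\nabla_y f_\mu(z))$. For $u=(u_1,u_2)\in\mathbb{R}^n\times\mathbb{R}^m$ the random oracle is $G_\mu(z;u)=\frac{f(z+\mu u)-f(z)}{\mu}\,(B_1u_1,-B_2u_2)$. $\mathrm{Proj}_{\mathcal{Z}}(w)=\arg\min_{z\in\mathcal{Z}}\|z-w\|^2$, and $P_{\mathcal{Z}}(z,h,g)=\frac1h\left[z-\mathrm{Proj}_{\mathcal{Z}}(z-hg)\right]$ for $h>0$, $g\in\mathbb{R}^d$. Variance-reduced ZO-EG (projected): given $z_0\in\mathcal{Z}$, for $k=0,1,\dots,N$: sample $\hat u_k^1,\dots,\hat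 u_k^{t_k}\sim\mathcal{N}(0,B^{-1})$ and set $\hat z_k=\mathrm{Proj}_{\mathcal{Z}}\big(z_k-h_{1,k}\frac{1}{t_k}\sum_{i=1}^{t_k}G_\mu(z_k;\hat u_k^i)\big)$; sample $u_k^1,\dots,u_k^{t_k}\sim\mathcal{N}(0,B^{-1})$ and set $z_{k+1}=\mathrm{Proj}_{\mathcal{Z}}\big(z_k-h_{2,k}\frac{1}{t_k}\sum_{i=1}^{t_k}G_\mu(\hat z_k;u_k^i)\big)$. All sampled vectors are independent. $\mathcal{U}_k=[(u_0,\hat u_0),\dots,(u_k,\hat u_k)]$, where $u_j,\hat u_j$ denote the batches sampled at iteration $j$, and $E_{\mathcal{U}_k}$ is expectation over $\mathcal{U}_k$. *)

theory Defs
  imports "HOL-Probability.Probability"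
begin

definition sym_pos_def :: "real^'n^'n \<Rightarrow> bool" where
  "sym_pos_def A \<longleftrightarrow> transpose A = A \<and> (\<forall>x. x \<noteq> 0 \<longrightarrow> 0 < x \<bullet> (A *v x))"

(* R^d with d = n + m is the product type (real^'n) * (real^'m), whose inner product and norm
   are the Euclidean ones. A matrix acting on it is represented by its linear map, so the
   inverse matrix of B is the function inverse inv B. *)

definition block_diag :: "real^'n^'n \<Rightarrow> real^'m^'m \<Rightarrow> (real^'n) \<times> (real^'m) \<Rightarrow> (real^'n) \<times> (real^'m)" where
  "block_diag B1 B2 z = (B1 *v fst z, B2 *v snd z)"

definition eigenvalues :: "('a::real_vector \<Rightarrow> 'a) \<Rightarrow> real set" where
  "eigenvalues B = {c. \<exists>v. v \<noteq> 0 \<and> B v = c *\<^sub>R v}"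

definition wnorm :: "('a::real_inner \<Rightarrow> 'a) \<Rightarrow> 'a \<Rightarrow> real" where
  "wnorm B z = sqrt (z \<bullet> B z)"

definition wnorm_dual :: "('a::real_inner \<Rightarrow> 'a) \<Rightarrow> 'a \<Rightarrow> real" where
  "wnorm_dual B z = sqrt (z \<bullet> inv B z)"

definition wdiameter :: "('a::real_inner \<Rightarrow> 'a) \<Rightarrow> 'a set \<Rightarrow> real" where
  "wdiameter B Z = Sup {wnorm B (z1 - z2) | z1 z2. z1 \<in> Z \<and> z2 \<in> Z}"

definition grad :: "('a::real_inner \<Rightarrow> real) \<Rightarrow> 'a \<Rightarrow> 'a" where
  "grad f z = (THE g. GDERIV f z :> g)"

definition saddle_op ::
  "((real^'n) \<times> (real^'m) \<Rightarrow> real) \<Rightarrow> (real^'n) \<times> (real^'m) \<Rightarrow> (real^'n) \<times> (real^'m)" where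
  "saddle_op f z = (grad (\<lambda>x. f (x, snd z)) (fst z), - grad (\<lambda>y. f (fst z, y)) (snd z))"

(* The law N(0, B^{-1}) for B = diag(B1, B2): its Lebesgue density is
   (2 pi)^(-d/2) (det B)^(1/2) exp (- <u, B u> / 2), where det B = det B1 * det B2. *)

definition gaussian :: "real^'n^'n \<Rightarrow> real^'m^'m \<Rightarrow> ((real^'n) \<times> (real^'m)) measure" where
  "gaussian B1 B2 = density lborel (\<lambda>u. ennreal
     (sqrt (det B1 * det B2 / (2 * pi) ^ (CARD('n) + CARD('m)))
       * exp (- (u \<bullet> block_diag B1 B2 u) / 2)))"

definition gauss_smoothing ::
  "real^'n^'n \<Rightarrow> real^'m^'m \<Rightarrow> real \<Rightarrow> ((real^'n) \<times> (real^'m) \<Rightarrow> real) \<Rightarrow> (real^'n) \<times> (real^'m) \<Rightarrow> real" where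
  "gauss_smoothing B1 B2 \<mu> f z = (\<integral>u. f (z + \<mu> *\<^sub>R u) \<partial>gaussian B1 B2)"

definition oracle_G ::
  "real^'n^'n \<Rightarrow> real^'m^'m \<Rightarrow> real \<Rightarrow> ((real^'n) \<times> (real^'m) \<Rightarrow> real)
    \<Rightarrow> (real^'n) \<times> (real^'m) \<Rightarrow> (real^'n) \<times> (real^'m) \<Rightarrow> (real^'n) \<times> (real^'m)" where
  "oracle_G B1 B2 \<mu> f z u =
     ((f (z + \<mu> *\<^sub>R u) - f z) / \<mu>) *\<^sub>R (B1 *v fst u, - (B2 *v snd u))"

definition avg_oracle ::
  "real^'n^'n \<Rightarrow> real^'m^'m \<Rightarrow> real \<Rightarrow> ((real^'n) \<times> (real^'m) \<Rightarrow> real)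
    \<Rightarrow> nat \<Rightarrow> (real^'n) \<times> (real^'m) \<Rightarrow> (nat \<Rightarrow> (real^'n) \<times> (real^'m)) \<Rightarrow> (real^'n) \<times> (real^'m)" where
  "avg_oracle B1 B2 \<mu> f t z u = (1 / real t) *\<^sub>R (\<Sum>i = 1..t. oracle_G B1 B2 \<mu> f z (u i))"

definition Proj :: "('a::real_inner \<Rightarrow> 'a) \<Rightarrow> 'a set \<Rightarrow> 'a \<Rightarrow> 'a" where
  "Proj B Z w = arg_min_on (\<lambda>z. (wnorm B (z - w))\<^sup>2) Z"

definition prox_map :: "('a::real_inner \<Rightarrow> 'a) \<Rightarrow> 'a set \<Rightarrow> 'a \<Rightarrow> real \<Rightarrow> 'a \<Rightarrow> 'a" where
  "prox_map B Z z h g = (1 / h) *\<^sub>R (z - Proj B Z (z - h *\<^sub>R g))"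

definition prox_weak_MVI ::
  "('a::real_inner \<Rightarrow> 'a) \<Rightarrow> 'a set \<Rightarrow> ('a \<Rightarrow> 'a) \<Rightarrow> real \<Rightarrow> 'a \<Rightarrow> bool" where
  "prox_weak_MVI B Z F \<rho> zstar \<longleftrightarrow>
     (\<forall>z\<in>Z. \<forall>zbar\<in>Z. \<forall>a>0.
        prox_map B Z z a (F zbar) \<bullet> (zbar - zstar)
          + \<rho> / 2 * (wnorm_dual B (prox_map B Z z a (F zbar)))\<^sup>2 \<ge> 0)"

(* Iterates of the projected variance-reduced zeroth-order extragradient method during the
   iterations k = 0, ..., N, for one realization uhat k i, u k i (1 <= i <= t k) of the samples. *)

definition vr_zo_eg ::
  "real^'n^'n \<Rightarrow> real^'m^'m \<Rightarrow> real \<Rightarrow> ((real^'n) \<times> (real^'m) \<Rightarrow> real) \<Rightarrow> ((real^'n) \<times> (real^'m)) set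
    \<Rightarrow> (nat \<Rightarrow> real) \<Rightarrow> (nat \<Rightarrow> real) \<Rightarrow> (nat \<Rightarrow> nat) \<Rightarrow> nat \<Rightarrow> (real^'n) \<times> (real^'m)
    \<Rightarrow> (nat \<Rightarrow> nat \<Rightarrow> (real^'n) \<times> (real^'m)) \<Rightarrow> (nat \<Rightarrow> nat \<Rightarrow> (real^'n) \<times> (real^'m))
    \<Rightarrow> (nat \<Rightarrow> (real^'n) \<times> (real^'m)) \<Rightarrow> (nat \<Rightarrow> (real^'n) \<times> (real^'m)) \<Rightarrow> bool" where
  "vr_zo_eg B1 B2 \<mu> f Z h1 h2 t N z0 uhat u z zhat \<longleftrightarrow>
     z 0 = z0 \<and>
     (\<forall>k\<le>N.
        zhat k = Proj (block_diag B1 B2) Z (z k - h1 k *\<^sub>R avg_oracle B1 B2 \<mu> f (t k) (z k) (uhat k)) \<and>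
        z (Suc k) = Proj (block_diag B1 B2) Z (z k - h2 k *\<^sub>R avg_oracle B1 B2 \<mu> f (t k) (zhat k) (u k)))"

(* All vectors sampled during the iterations k = 0, ..., N: the pairs (k, i) are tagged True
   for uhat and False for u, so that joint independence of both families is one indep_vars. *)

definition gaussian_samples ::
  "'w measure \<Rightarrow> real^'n^'n \<Rightarrow> real^'m^'m \<Rightarrow> (nat \<Rightarrow> nat) \<Rightarrow> nat
    \<Rightarrow> (nat \<Rightarrow> nat \<Rightarrow> 'w \<Rightarrow> (real^'n) \<times> (real^'m))
    \<Rightarrow> (nat \<Rightarrow> nat \<Rightarrow> 'w \<Rightarrow> (real^'n) \<times> (real^'m)) \<Rightarrow> bool" where
  "gaussian_samples M B1 B2 t N uhat u \<longleftrightarrow>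
     prob_space M \<and>
     prob_space.indep_vars M (\<lambda>_. borel) (\<lambda>(b, k, i). if b then uhat k i else u k i)
       {(b, k, i). k \<le> N \<and> i \<in> {1..t k}} \<and>
     (\<forall>k\<le>N. \<forall>i\<in>{1..t k}.
        distr M borel (uhat k i) = gaussian B1 B2 \<and> distr M borel (u k i) = gaussian B1 B2)"

end

theory Submission
  imports Defs
begin

text \<open>
  Since \<open>B\<close> is positive definite, all norms involved are equivalent with constants
  given by the extreme eigenvalues, and the projection in the norm \<open>wnorm B\<close> is nonexpansive.
  Gaussian integration by parts shows that the oracle is unbiased for the gradient of
  the smoothed function, whose distance to the true gradient is at most \<open>\<mu> L1 E(wnorm B u)\<close>, and
  \<open>E(wnorm B u)\<^sup>2 = d\<close>. An extragradient step decreases the Euclidean distance to \<open>zstar\<close>: the weak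
  Minty inequality is applied to the step that uses the exact operator at \<open>zhat\<close>, and the
  difference to the actual step is controlled by bias and noise. Each batch is independent of
  the point at which it is evaluated, so its noise has second moment at most \<open>\<sigma>\<^sup>2 / t k\<close>; the
  per-step bounds are then averaged and telescoped.
\<close>

subsection \<open>Norms of positive definite operators\<close>

text \<open>The distance to \<open>zstar\<close> is measured in the Euclidean norm, but
  \<open>Proj\<close> is nonexpansive in \<open>wnorm B\<close>. The descent therefore rests on the
  identity |zp - zs|^2 = |z - zs|^2 - |z - zh|^2 + |zp - zh|^2 - 2 <z - zp, zh - zs>, valid for
  arbitrary points; projections enter through their Lipschitz dependence on the step direction, and
  each change of norm costs eigenvalue factors. Since the Minty inequality speaks of steps with the
  exact operator, z - zp is split at the step \<open>zt\<close> that uses the operator at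
  \<open>zh\<close> without noise. The part zt - zp is paired with zh - zs, which the diameter
  bounds; it stays linear in the noise, and this is the origin of the terms with \<open>Dz\<close>
  and \<open>1 / sqrt (t k)\<close>. Unbiasedness acts inside a batch, where it removes the cross
  terms of the variance. The upper bound on the step size amounts to
  \<open>h * L * \<kappa> * lmax \<le> 1 / 2\<close>, which keeps half of |z - zh|^2 on the
  left-hand side before the Minty term is subtracted.\<close>

locale pos_def_op =
  fixes B :: "'a::euclidean_space \<Rightarrow> 'a"
  assumes lin: "linear B"
    and self_adj: "x \<bullet> B y = B x \<bullet> y"
    and pos: "x \<noteq> 0 \<Longrightarrow> 0 < x \<bullet> B x"
begin

lemmas lin_simps = linear_add[OF lin] linear_diff[OF lin] linear_scale[OF lin] linear_neg[OF lin]
  linear_0[OF lin]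

lemma nonneg: "0 \<le> x \<bullet> B x"
  using pos[of x] by (cases "x = 0") auto

lemma wnorm_sq: "(wnorm B x)\<^sup>2 = x \<bullet> B x"
  by (simp add: wnorm_def nonneg)

lemma wnorm_nonneg: "0 \<le> wnorm B x"
  by (simp add: wnorm_def nonneg)

lemma inner_B_commute: "y \<bullet> B x = x \<bullet> B y"
  by (metis inner_commute self_adj)

text \<open>Positivity of the form at \<open>c *\<^sub>R x - e *\<^sub>R y\<close>, the residual of
  projecting \<open>x\<close> on \<open>y\<close> with the denominator \<open>c\<close>
  cleared.\<close>

lemma Cauchy_Schwarz_sq: "(x \<bullet> B y)\<^sup>2 \<le> (x \<bullet> B x) * (y \<bullet> B y)"
proof (cases "y = 0")
  case False
  define c where "c = y \<bullet> B y"
  define e where "e = x \<bullet> B y"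
  have c: "c > 0" using pos[OF False] by (simp add: c_def)
  have "0 \<le> (c *\<^sub>R x - e *\<^sub>R y) \<bullet> B (c *\<^sub>R x - e *\<^sub>R y)"
    by (rule nonneg)
  also have "\<dots> = c * (c * (x \<bullet> B x) - e\<^sup>2)"
    using inner_B_commute[of y x]
    by (simp add: lin_simps inner_diff_left inner_diff_right c_def e_def algebra_simps power2_eq_square)
  finally have "e\<^sup>2 \<le> c * (x \<bullet> B x)"
    using c by (simp add: zero_le_mult_iff)
  then show ?thesis by (simp add: c_def e_def mult.commute)
qed (simp add: lin_simps)

lemma Cauchy_Schwarz_wnorm: "\<bar>x \<bullet> B y\<bar> \<le> wnorm B x * wnorm B y"
proof -
  have "(x \<bullet> B y)\<^sup>2 \<le> (wnorm B x * wnorm B y)\<^sup>2"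
    using Cauchy_Schwarz_sq by (simp add: power_mult_distrib wnorm_sq)
  then show ?thesis
    by (metis abs_le_square_iff abs_of_nonneg mult_nonneg_nonneg wnorm_nonneg)
qed

lemma wnorm_add_sq: "(wnorm B (x + y))\<^sup>2 = (wnorm B x)\<^sup>2 + 2 * (x \<bullet> B y) + (wnorm B y)\<^sup>2"
  using inner_B_commute[of y x] by (simp add: wnorm_sq lin_simps inner_add_left inner_add_right)

lemma wnorm_triangle: "wnorm B (x + y) \<le> wnorm B x + wnorm B y"
proof (rule power2_le_imp_le)
  have "(wnorm B (x + y))\<^sup>2 \<le> (wnorm B x)\<^sup>2 + 2 * (wnorm B x * wnorm B y) + (wnorm B y)\<^sup>2"
    using Cauchy_Schwarz_wnorm[of x y] by (simp add: wnorm_add_sq)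
  also have "\<dots> = (wnorm B x + wnorm B y)\<^sup>2"
    by (simp add: power2_sum)
  finally show "(wnorm B (x + y))\<^sup>2 \<le> (wnorm B x + wnorm B y)\<^sup>2" .
qed (simp add: wnorm_nonneg)

lemma wnorm_scale: "wnorm B (c *\<^sub>R x) = \<bar>c\<bar> * wnorm B x"
  by (simp add: wnorm_def lin_simps real_sqrt_mult flip: mult.assoc power2_eq_square)

lemma wnorm_minus: "wnorm B (- x) = wnorm B x"
  by (simp add: wnorm_def lin_simps)

lemma wnorm_minus_commute: "wnorm B (x - y) = wnorm B (y - x)"
  using wnorm_minus[of "x - y"] by simp

lemma continuous_on_B [continuous_intros]: "continuous_on S g \<Longrightarrow> continuous_on S (\<lambda>x. B (g x))"
  using continuous_on_compose2[OF linear_continuous_on[OF lin[unfolded linear_conv_bounded_linear]]]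
  by blast

lemma measurable_B [measurable]: "B \<in> borel_measurable borel"
  by (intro borel_measurable_continuous_onI continuous_intros)

lemma measurable_wnorm [measurable]: "wnorm B \<in> borel_measurable borel"
  unfolding wnorm_def by measurable

lemma bij: "bij B"
proof -
  have "inj B"
    using pos lin_simps(5) by (subst linear_injective_0[OF lin]) force
  then show ?thesis
    by (simp add: bij_def linear_injective_imp_surjective[OF lin])
qed

lemma B_inv [simp]: "B (inv B x) = x"
  by (meson bij bij_inv_eq_iff)

lemma inv_B [simp]: "inv B (B x) = x"
  by (simp add: bij bij_is_inj)

lemma pos_def_op_inv: "pos_def_op (inv B)"
proof (rule pos_def_op.intro)
  show "linear (inv B)"
  proof (rule linearI)
    show "inv B (x + y) = inv B x + inv B y" for x y
      by (metis B_inv inv_B lin_simps(1))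
    show "inv B (c *\<^sub>R x) = c *\<^sub>R inv B x" for c x
      by (metis B_inv inv_B lin_simps(3))
  qed
  show "x \<bullet> inv B y = inv B x \<bullet> y" for x y
    using self_adj[of "inv B x" "inv B y"] by simp
  show "0 < x \<bullet> inv B x" if "x \<noteq> 0" for x
    using pos[of "inv B x"] that by (metis B_inv inner_commute lin_simps(5))
qed

end

subsection \<open>Spectral bounds\<close>

text \<open>One eigenvector per eigenvalue gives an orthogonal family of nonzero vectors, hence an
  independent one. Finiteness is what gives \<open>Min\<close> and \<open>Max\<close> of the
  spectrum their meaning.\<close>

lemma finite_eigenvalues:
  fixes B :: "'a::euclidean_space \<Rightarrow> 'a"
  assumes self_adj: "\<And>x y. x \<bullet> B y = B x \<bullet> y"
  shows "finite (eigenvalues B)"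
proof -
  define v where "v c = (SOME v. v \<noteq> 0 \<and> B v = c *\<^sub>R v)" for c
  have v: "v c \<noteq> 0" "B (v c) = c *\<^sub>R v c" if "c \<in> eigenvalues B" for c
    using someI_ex[of "\<lambda>v. v \<noteq> 0 \<and> B v = c *\<^sub>R v"] that by (auto simp: eigenvalues_def v_def)
  have orth: "v c \<bullet> v c' = 0" if "c \<in> eigenvalues B" "c' \<in> eigenvalues B" "c \<noteq> c'" for c c'
    using self_adj[of "v c" "v c'"] v[OF that(1)] v[OF that(2)] that(3) by simp
  have inj: "inj_on v (eigenvalues B)"
    by (rule inj_onI) (metis inner_eq_zero_iff orth v(1))
  have "independent (v ` eigenvalues B)"
    using orth v(1)
    by (intro pairwise_orthogonal_independent) (force simp: pairwise_def orthogonal_def)+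
  then show ?thesis
    using independent_bound inj finite_imageD by blast
qed

context pos_def_op
begin

text \<open>Both extremal Rayleigh quotients are attained on the unit sphere and their optimisers are
  eigenvectors; \<open>s\<close> is the sign selecting minimum or maximum.\<close>

lemma Rayleigh:
  fixes s :: real
  assumes s: "s \<noteq> 0"
  obtains c where "c \<in> eigenvalues B" "\<And>x. s * c * (norm x)\<^sup>2 \<le> s * (x \<bullet> B x)"
proof -
  have ne: "sphere (0::'a) 1 \<noteq> {}" by simp
  have "continuous_on (sphere 0 1) (\<lambda>x. s * (x \<bullet> B x))"
    by (intro continuous_intros)
  from continuous_attains_inf[OF compact_sphere ne this]
  obtain v where v: "norm v = 1" and v_min: "\<And>x. norm x = 1 \<Longrightarrow> s * (v \<bullet> B v) \<le> s * (x \<bullet> B x)"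
    by auto
  define c where "c = v \<bullet> B v"
  have low: "s * c * (norm x)\<^sup>2 \<le> s * (x \<bullet> B x)" for x
  proof (cases "x = 0")
    case False
    have "s * c \<le> s * ((x /\<^sub>R norm x) \<bullet> B (x /\<^sub>R norm x))"
      unfolding c_def by (rule v_min) (simp add: False)
    also have "\<dots> = s * (x \<bullet> B x) / (norm x)\<^sup>2"
      by (simp add: lin_simps power2_eq_square field_simps)
    finally show ?thesis
      using False by (simp add: field_simps)
  qed (simp add: lin_simps)
  \<comment> \<open>\<open>w\<close> is the residual of the eigenvalue equation at the optimiser
    \<open>v\<close>, scaled by \<open>s\<close>. Moving from \<open>v\<close> along
    \<open>w\<close> changes the nonnegative Rayleigh gap to first order by
    \<open>2 * e * (w \<bullet> w)\<close>, so a small negative \<open>e\<close> contradicts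
    optimality unless \<open>w = 0\<close>.\<close>
  define w where "w = s *\<^sub>R (B v - c *\<^sub>R v)"
  have quad: "0 \<le> 2 * e * (w \<bullet> w) + e\<^sup>2 * (s * (w \<bullet> B w) - s * c * (w \<bullet> w))" for e
  proof -
    have "0 \<le> s * ((v + e *\<^sub>R w) \<bullet> B (v + e *\<^sub>R w)) - s * c * ((v + e *\<^sub>R w) \<bullet> (v + e *\<^sub>R w))"
      using low[of "v + e *\<^sub>R w"] by (simp add: power2_norm_eq_inner)
    also have "\<dots> = 2 * e * (w \<bullet> (s *\<^sub>R B v - (s * c) *\<^sub>R v)) + e\<^sup>2 * (s * (w \<bullet> B w) - s * c * (w \<bullet> w))
        + (s * (v \<bullet> B v) - s * c * (v \<bullet> v))"
      using inner_B_commute[of v w] inner_commute[of v w]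
      by (simp add: lin_simps inner_add_left inner_add_right inner_diff_right power2_eq_square algebra_simps)
    also have "v \<bullet> v = 1" using v by (simp add: norm_eq_1)
    also have "s *\<^sub>R B v - (s * c) *\<^sub>R v = w"
      by (simp add: w_def scaleR_diff_right)
    finally show ?thesis by (simp add: c_def)
  qed
  have "w = 0"
  proof (rule ccontr)
    assume "w \<noteq> 0"
    then have ww: "0 < w \<bullet> w" by simp
    define q where "q = s * (w \<bullet> B w) - s * c * (w \<bullet> w)"
    \<comment> \<open>Chosen so that \<open>e * (\<bar>q\<bar> + 1)\<close> equals
      \<open>w \<bullet> w\<close>: the quadratic term is then too small to compensate the linear
      one.\<close>
    define e where "e = (w \<bullet> w) / (\<bar>q\<bar> + 1)"
    have e: "0 < e" using ww by (simp add: e_def add_nonneg_pos)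
    have "0 \<le> 2 * (- e) * (w \<bullet> w) + (- e)\<^sup>2 * q" using quad[of "- e"] by (simp add: q_def)
    then have "e * (2 * (w \<bullet> w)) \<le> e * (e * q)" by (simp add: power2_eq_square algebra_simps)
    then have "2 * (w \<bullet> w) \<le> e * q" using e by simp
    also have "\<dots> \<le> e * (\<bar>q\<bar> + 1)" using e by (intro mult_left_mono) auto
    also have "\<dots> = w \<bullet> w" using abs_ge_zero[of q] by (simp add: e_def)
    finally show False using ww by simp
  qed
  then have "B v = c *\<^sub>R v" using s by (simp add: w_def)
  moreover have "v \<noteq> 0" using v by auto
  ultimately have "c \<in> eigenvalues B" by (auto simp: eigenvalues_def)
  then show ?thesis using low that by blast
qed

lemma finite_eigenvalues_B: "finite (eigenvalues B)"
  by (rule finite_eigenvalues) (rule self_adj)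

lemma eigenvalue_pos: "c \<in> eigenvalues B \<Longrightarrow> 0 < c"
  using pos by (auto simp: eigenvalues_def) (metis inner_scaleR_right inner_gt_zero_iff zero_less_mult_pos2)

lemma eigenvalues_nonempty: "eigenvalues B \<noteq> {}"
  using Rayleigh[of 1] by auto

lemma Min_eigenvalue_pos: "0 < Min (eigenvalues B)"
  by (simp add: finite_eigenvalues_B eigenvalues_nonempty eigenvalue_pos)

lemma Min_le_Max_eigenvalue: "Min (eigenvalues B) \<le> Max (eigenvalues B)"
  using Min_in[OF finite_eigenvalues_B eigenvalues_nonempty] by (simp add: finite_eigenvalues_B)

text \<open>The value supplied by \<open>Rayleigh\<close> is an eigenvalue, hence at least the
  minimum, which is the direction wanted here. The sign \<open>- 1\<close> gives the upper bound in
  the same way.\<close>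

lemma Min_eigenvalue_le: "Min (eigenvalues B) * (norm x)\<^sup>2 \<le> x \<bullet> B x"
proof -
  obtain c where "c \<in> eigenvalues B" "\<And>x. 1 * c * (norm x)\<^sup>2 \<le> 1 * (x \<bullet> B x)"
    using Rayleigh[of 1] by auto
  moreover from this(1) have "Min (eigenvalues B) * (norm x)\<^sup>2 \<le> c * (norm x)\<^sup>2"
    by (intro mult_right_mono) (simp_all add: finite_eigenvalues_B)
  ultimately show ?thesis by (metis mult_1 order_trans)
qed

lemma le_Max_eigenvalue: "x \<bullet> B x \<le> Max (eigenvalues B) * (norm x)\<^sup>2"
proof -
  obtain c where "c \<in> eigenvalues B" "\<And>x. (- 1) * c * (norm x)\<^sup>2 \<le> (- 1) * (x \<bullet> B x)"
    using Rayleigh[of "- 1"] by auto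
  moreover from this(1) have "c * (norm x)\<^sup>2 \<le> Max (eigenvalues B) * (norm x)\<^sup>2"
    by (intro mult_right_mono) (simp_all add: finite_eigenvalues_B)
  ultimately show ?thesis by (smt (verit) mult_minus1 mult_minus_left)
qed

end

section \<open>Comparison of the weighted norms with the Euclidean norm\<close>

locale pos_def_op_bounds = pos_def_op +
  fixes lmin lmax :: real
  assumes lmin_pos: "0 < lmin" and lmin_le_lmax: "lmin \<le> lmax"
    and lmin_le: "lmin * (norm x)\<^sup>2 \<le> x \<bullet> B x"
    and le_lmax: "x \<bullet> B x \<le> lmax * (norm x)\<^sup>2"
begin

text \<open>The dual norm is the weighted norm of the inverse operator, so the whole theory of
  \<open>wnorm\<close> carries over to it.\<close>

sublocale dual: pos_def_op "inv B"
  rewrites "wnorm (inv B) = wnorm_dual B"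
  by (rule pos_def_op_inv) (simp add: wnorm_def[abs_def] wnorm_dual_def[abs_def])

lemma wnorm_dual_B: "wnorm_dual B (B x) = wnorm B x"
  by (simp add: wnorm_def wnorm_dual_def inner_commute)

lemma inner_le_wnorm: "\<bar>x \<bullet> y\<bar> \<le> wnorm_dual B x * wnorm B y"
  using dual.Cauchy_Schwarz_wnorm[of x "B y"] by (simp add: wnorm_dual_B)

lemma lmax_pos: "0 < lmax" using lmin_pos lmin_le_lmax by simp

lemma norm_le_wnorm: "sqrt lmin * norm x \<le> wnorm B x"
proof -
  have "sqrt (lmin * (norm x)\<^sup>2) \<le> wnorm B x"
    unfolding wnorm_def by (rule real_sqrt_le_mono) (rule lmin_le)
  then show ?thesis by (simp add: real_sqrt_mult)
qed

lemma wnorm_le_norm: "wnorm B x \<le> sqrt lmax * norm x"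
proof -
  have "wnorm B x \<le> sqrt (lmax * (norm x)\<^sup>2)"
    unfolding wnorm_def by (rule real_sqrt_le_mono) (rule le_lmax)
  then show ?thesis by (simp add: real_sqrt_mult)
qed

text \<open>With \<open>w = inv B x\<close> the squared dual norm is \<open>x \<bullet> w\<close>,
  and \<open>sqrt lmin * norm w\<close> is at most \<open>wnorm B w\<close>, which equals the dual
  norm of \<open>x\<close>. Thus the spectrum of the inverse operator is never examined.\<close>

lemma wnorm_dual_le_norm: "sqrt lmin * wnorm_dual B x \<le> norm x"
proof (cases "x = 0")
  case False
  define w where "w = inv B x"
  have w: "B w = x" by (simp add: w_def)
  have "(wnorm_dual B x)\<^sup>2 = x \<bullet> w" by (simp add: dual.wnorm_sq w_def)
  also have "\<dots> \<le> norm x * norm w" by (rule norm_cauchy_schwarz)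
  finally have 1: "(wnorm_dual B x)\<^sup>2 \<le> norm x * norm w" .
  have "sqrt lmin * norm w \<le> wnorm_dual B x"
    using norm_le_wnorm[of w] wnorm_dual_B[of w] w by simp
  then have "norm x * (sqrt lmin * norm w) \<le> norm x * wnorm_dual B x"
    by (rule mult_left_mono) simp
  moreover have "sqrt lmin * (wnorm_dual B x)\<^sup>2 \<le> sqrt lmin * (norm x * norm w)"
    using 1 lmin_pos by (intro mult_left_mono) auto
  ultimately have "sqrt lmin * (wnorm_dual B x)\<^sup>2 \<le> norm x * wnorm_dual B x"
    by (simp add: mult.left_commute)
  moreover have "0 < wnorm_dual B x"
    using dual.pos[OF False] by (simp add: wnorm_dual_def)
  ultimately show ?thesis by (simp add: power2_eq_square)
qed (simp add: wnorm_dual_def dual.lin_simps)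

text \<open>Pairing \<open>x\<close> with itself by duality leaves one factor
  \<open>wnorm B x\<close>, which costs \<open>sqrt lmax\<close>.\<close>

lemma norm_le_wnorm_dual: "norm x \<le> sqrt lmax * wnorm_dual B x"
proof (cases "x = 0")
  case False
  have "(norm x)\<^sup>2 = \<bar>x \<bullet> x\<bar>" by (simp add: power2_norm_eq_inner)
  also have "\<dots> \<le> wnorm_dual B x * wnorm B x" by (rule inner_le_wnorm)
  also have "\<dots> \<le> wnorm_dual B x * (sqrt lmax * norm x)"
    by (intro mult_left_mono wnorm_le_norm dual.wnorm_nonneg)
  finally have "norm x * norm x \<le> (sqrt lmax * wnorm_dual B x) * norm x"
    by (simp add: power2_eq_square algebra_simps)
  then show ?thesis using False by simp
qed (simp add: wnorm_dual_def)

lemma wnorm_le_wnorm_dual: "wnorm B x \<le> lmax * wnorm_dual B x"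
proof -
  have "wnorm B x \<le> sqrt lmax * norm x" by (rule wnorm_le_norm)
  also have "\<dots> \<le> sqrt lmax * (sqrt lmax * wnorm_dual B x)"
    using lmax_pos by (intro mult_left_mono norm_le_wnorm_dual) simp
  also have "\<dots> = lmax * wnorm_dual B x" using lmax_pos by (simp flip: mult.assoc)
  finally show ?thesis .
qed

lemma wnorm_dual_le_wnorm: "lmin * wnorm_dual B x \<le> wnorm B x"
proof -
  have "lmin * wnorm_dual B x = sqrt lmin * (sqrt lmin * wnorm_dual B x)"
    using lmin_pos by (simp flip: mult.assoc)
  also have "\<dots> \<le> sqrt lmin * norm x"
    using lmin_pos by (intro mult_left_mono wnorm_dual_le_norm) simp
  also have "\<dots> \<le> wnorm B x" by (rule norm_le_wnorm)
  finally show ?thesis .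
qed

end

subsection \<open>Projection\<close>

context pos_def_op
begin

text \<open>\<open>Proj\<close> is a Hilbert choice among minimisers; compactness supplies a
  minimiser, so the choice is a genuine one.\<close>

lemma Proj_minimal:
  assumes Z: "compact Z" "Z \<noteq> {}"
  shows "Proj B Z w \<in> Z" "y \<in> Z \<Longrightarrow> wnorm B (Proj B Z w - w) \<le> wnorm B (y - w)"
proof -
  have "continuous_on Z (\<lambda>y. (wnorm B (y - w))\<^sup>2)"
    unfolding wnorm_sq by (intro continuous_intros)
  from continuous_attains_inf[OF Z this]
  obtain x where "x \<in> Z" "\<forall>y\<in>Z. (wnorm B (x - w))\<^sup>2 \<le> (wnorm B (y - w))\<^sup>2" by auto
  then have "\<exists>x. is_arg_min (\<lambda>y. (wnorm B (y - w))\<^sup>2) (\<lambda>y. y \<in> Z) x"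
    by (auto simp: is_arg_min_linorder)
  then have "is_arg_min (\<lambda>y. (wnorm B (y - w))\<^sup>2) (\<lambda>y. y \<in> Z) (Proj B Z w)"
    unfolding Proj_def arg_min_on_def arg_min_def by (rule someI_ex)
  then show "Proj B Z w \<in> Z" "y \<in> Z \<Longrightarrow> wnorm B (Proj B Z w - w) \<le> wnorm B (y - w)"
    by (auto simp: is_arg_min_linorder wnorm_nonneg)
qed

text \<open>First-order optimality: moving from the projection towards \<open>y\<close> by a
  fraction \<open>e\<close> changes the squared distance by
  \<open>2 * e * a + e\<^sup>2 * q\<close>, which is negative for small \<open>e\<close> if
  \<open>a < 0\<close>.\<close>

lemma Proj_variational:
  assumes Z: "compact Z" "Z \<noteq> {}" "convex Z" and y: "y \<in> Z"
  shows "0 \<le> (y - Proj B Z w) \<bullet> B (Proj B Z w - w)"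
proof (rule ccontr)
  define p where "p = Proj B Z w"
  define a where "a = (y - p) \<bullet> B (p - w)"
  define q where "q = (y - p) \<bullet> B (y - p)"
  assume "\<not> ?thesis"
  then have a: "a < 0" by (simp add: a_def p_def)
  have q: "0 \<le> q" unfolding q_def by (rule nonneg)
  \<comment> \<open>The bound \<open>1\<close> keeps the point in the convex set; the other one
    gives \<open>e * q \<le> - a\<close>, so that the sum \<open>2 * a + e * q\<close> is at most
    \<open>a\<close>.\<close>
  define e where "e = min 1 (- a / (q + 1))"
  have e: "0 < e" "e \<le> 1" using a q by (auto simp: e_def divide_neg_pos)
  have "p + e *\<^sub>R (y - p) = (1 - e) *\<^sub>R p + e *\<^sub>R y" by (simp add: algebra_simps)
  then have "p + e *\<^sub>R (y - p) \<in> Z"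
    using convexD[OF Z(3) Proj_minimal(1)[OF Z(1,2)] y, of "1 - e" e] e by (simp add: p_def)
  then have "(wnorm B (p - w))\<^sup>2 \<le> (wnorm B (p + e *\<^sub>R (y - p) - w))\<^sup>2"
    using Proj_minimal(2)[OF Z(1,2)] by (intro power_mono wnorm_nonneg) (auto simp: p_def)
  also have "p + e *\<^sub>R (y - p) - w = (p - w) + e *\<^sub>R (y - p)" by simp
  also have "(wnorm B \<dots>)\<^sup>2 = (wnorm B (p - w))\<^sup>2 + 2 * e * a + e\<^sup>2 * q"
    unfolding wnorm_add_sq using inner_B_commute[of "p - w" "y - p"]
    by (simp add: wnorm_scale power_mult_distrib wnorm_sq lin_simps(3) a_def q_def)
  finally have "0 \<le> e * (2 * a + e * q)" by (simp add: power2_eq_square algebra_simps)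
  then have 0: "0 \<le> 2 * a + e * q" using e by (simp add: zero_le_mult_iff)
  have "e * q \<le> (- a / (q + 1)) * (q + 1)"
    using q a e by (intro mult_mono) (auto simp: e_def)
  also have "\<dots> = - a" using q by simp
  finally show False using 0 a by simp
qed

text \<open>Testing the variational inequality of each projection with the other one and adding
  bounds the squared distance by an inner product with \<open>B (v - w)\<close>.\<close>

lemma Proj_nonexpansive:
  assumes Z: "compact Z" "Z \<noteq> {}" "convex Z"
  shows "wnorm B (Proj B Z v - Proj B Z w) \<le> wnorm B (v - w)"
proof -
  define p q where "p = Proj B Z v" and "q = Proj B Z w"
  have "0 \<le> (q - p) \<bullet> B (p - v)" "0 \<le> (p - q) \<bullet> B (q - w)"
    unfolding p_def q_def by (auto intro!: Proj_variational Z Proj_minimal)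
  then have "(p - q) \<bullet> B (p - q) \<le> (p - q) \<bullet> B (v - w)"
    by (simp add: lin_simps inner_diff_left inner_diff_right)
  also have "\<dots> \<le> wnorm B (p - q) * wnorm B (v - w)"
    using Cauchy_Schwarz_wnorm[of "p - q" "v - w"] by simp
  finally have "(wnorm B (p - q))\<^sup>2 \<le> wnorm B (p - q) * wnorm B (v - w)" by (simp add: wnorm_sq)
  then show ?thesis
    unfolding p_def[symmetric] q_def[symmetric]
    by (cases "wnorm B (p - q) = 0")
      (use wnorm_nonneg[of "p - q"] wnorm_nonneg[of "v - w"] in \<open>auto simp: power2_eq_square\<close>)
qed

text \<open>A real \<open>Sup\<close> bounds its set only if the set is bounded above; here this
  comes from compactness of \<open>Z \<times> Z\<close>.\<close>

lemma wnorm_le_wdiameter: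
  assumes "compact Z" "x \<in> Z" "y \<in> Z"
  shows "wnorm B (x - y) \<le> wdiameter B Z"
proof -
  have "compact ((\<lambda>(x, y). wnorm B (x - y)) ` (Z \<times> Z))"
    unfolding wnorm_def case_prod_unfold
    using assms(1) by (intro compact_continuous_image compact_Times continuous_intros)
  then have "bdd_above ((\<lambda>(x, y). wnorm B (x - y)) ` (Z \<times> Z))"
    by (intro bounded_imp_bdd_above compact_imp_bounded)
  moreover have "(\<lambda>(x, y). wnorm B (x - y)) ` (Z \<times> Z) = {wnorm B (x - y) | x y. x \<in> Z \<and> y \<in> Z}"
    by auto
  ultimately show ?thesis
    unfolding wdiameter_def using assms(2,3) by (auto intro!: cSup_upper)
qed

end

context pos_def_op_bounds
begin

text \<open>Needed for measurability of the iterates. Nonexpansiveness in \<open>wnorm B\<close>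
  becomes a Euclidean Lipschitz constant \<open>sqrt lmax / sqrt lmin\<close>.\<close>

lemma continuous_Proj:
  assumes Z: "compact Z" "Z \<noteq> {}" "convex Z"
  shows "continuous_on UNIV (Proj B Z)"
proof (rule continuous_onI)
  fix x :: 'a and e :: real assume e: "0 < e"
  define K where "K = sqrt lmax / sqrt lmin"
  have K: "0 < K" using lmin_pos lmax_pos by (simp add: K_def)
  have "dist (Proj B Z y) (Proj B Z x) \<le> K * dist y x" for y
  proof -
    have "sqrt lmin * norm (Proj B Z y - Proj B Z x) \<le> wnorm B (Proj B Z y - Proj B Z x)"
      by (rule norm_le_wnorm)
    also have "\<dots> \<le> wnorm B (y - x)" by (rule Proj_nonexpansive[OF Z])
    also have "\<dots> \<le> sqrt lmax * norm (y - x)" by (rule wnorm_le_norm)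
    finally show ?thesis using lmin_pos by (simp add: K_def dist_norm field_simps)
  qed
  then have "dist y x < e / K \<Longrightarrow> dist (Proj B Z y) (Proj B Z x) \<le> e" for y
    using K by (smt (verit) mult.commute pos_less_divide_eq)
  then show "\<exists>d>0. \<forall>y\<in>UNIV. dist y x < d \<longrightarrow> dist (Proj B Z y) (Proj B Z x) \<le> e"
    using e K by (intro exI[of _ "e / K"]) auto
qed

end

context pos_def_op_bounds
begin

lemma norm_B_le: "norm (B x) \<le> lmax * norm x"
proof -
  have "norm (B x) \<le> sqrt lmax * wnorm B x"
    using norm_le_wnorm_dual[of "B x"] by (simp add: wnorm_dual_B)
  also have "\<dots> \<le> sqrt lmax * (sqrt lmax * norm x)"
    using lmax_pos by (intro mult_left_mono wnorm_le_norm) simp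
  finally show ?thesis using lmax_pos by (simp flip: mult.assoc)
qed

end

subsection \<open>Gaussian integration by parts\<close>

lemma DERIV_along_line:
  assumes "GDERIV f (x + s *\<^sub>R v) :> D"
  shows "DERIV (\<lambda>s. f (x + s *\<^sub>R v)) s :> D \<bullet> v"
proof -
  have "((\<lambda>s. x + s *\<^sub>R v) has_derivative (\<lambda>h. h *\<^sub>R v)) (at s)"
    by (auto intro!: derivative_eq_intros)
  from has_derivative_compose[OF this assms[unfolded gderiv_def]]
  show ?thesis
    by (simp add: has_field_derivative_def inner_commute mult_commute_abs)
qed

text \<open>The integrand factors over the coordinates into one-dimensional normal densities of
  variance \<open>1 / (2 * a)\<close>, up to a constant.\<close>

lemma integrable_exp_neg_norm_sq:
  fixes a :: real
  assumes a: "0 < a"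
  shows "integrable lborel (\<lambda>x::'a::euclidean_space. exp (- a * (norm x)\<^sup>2))"
proof -
  define \<sigma> where "\<sigma> = sqrt (1 / (2 * a))"
  have \<sigma>: "\<sigma> > 0" "\<sigma>\<^sup>2 = 1 / (2 * a)" using a by (auto simp: \<sigma>_def)
  have "integrable lborel (\<lambda>t. sqrt (2 * pi * \<sigma>\<^sup>2) * normal_density 0 \<sigma> t)"
    using \<sigma> by simp
  also have "(\<lambda>t. sqrt (2 * pi * \<sigma>\<^sup>2) * normal_density 0 \<sigma> t) = (\<lambda>t. exp (- a * t\<^sup>2))"
    using a \<sigma>(1) by (auto simp: normal_density_def fun_eq_iff \<sigma>(2) algebra_simps)
  finally have 1: "integrable lborel (\<lambda>t::real. exp (- a * t\<^sup>2))" .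
  have fin: "(\<integral>\<^sup>+ t. ennreal (exp (- a * t\<^sup>2)) \<partial>lborel) < \<infinity>"
    using 1 by (simp add: integrable_iff_bounded)
  have "(\<integral>\<^sup>+ x. ennreal (norm (exp (- a * (norm x)\<^sup>2))) \<partial>(lborel::'a measure))
      = (\<integral>\<^sup>+ x. (\<Prod>b\<in>Basis. ennreal (exp (- a * (x \<bullet> b)\<^sup>2))) \<partial>(lborel::'a measure))"
  proof (intro nn_integral_cong)
    fix x :: 'a
    have "(norm x)\<^sup>2 = (\<Sum>b\<in>Basis. (x \<bullet> b)\<^sup>2)"
      unfolding power2_norm_eq_inner by (subst euclidean_inner) (simp add: power2_eq_square)
    then show "ennreal (norm (exp (- a * (norm x)\<^sup>2))) = (\<Prod>b\<in>Basis. ennreal (exp (- a * (x \<bullet> b)\<^sup>2)))"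
      by (simp add: prod_ennreal exp_sum sum_distrib_left sum_negf[symmetric] prod_nonneg)
  qed
  also have "\<dots> = (\<Prod>b\<in>(Basis::'a set). \<integral>\<^sup>+ t. ennreal (exp (- a * t\<^sup>2)) \<partial>lborel)"
    by (rule nn_integral_lborel_prod) auto
  also have "\<dots> < \<infinity>" using fin by (simp add: less_top[symmetric] power_eq_top_ennreal)
  finally show ?thesis by (simp add: integrable_iff_bounded)
qed

text \<open>Half of the Gaussian decay pays for the polynomial: \<open>(1 + r) ^ k\<close> is at
  most \<open>fact k * exp (1 + r)\<close>, and completing the square gives
  \<open>r \<le> a * r\<^sup>2 + 1 / (4 * a)\<close>.\<close>

lemma poly_times_exp_neg_sq_le:
  fixes a r :: real
  assumes a: "0 < a" and r: "0 \<le> r"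
  shows "(1 + r) ^ k * exp (- (2 * a) * r\<^sup>2) \<le> fact k * exp (1 + 1 / (4 * a)) * exp (- a * r\<^sup>2)"
proof -
  have "(1 + r) ^ k / fact k \<le> exp (1 + r)"
  proof -
    have "(1 + r) ^ k /\<^sub>R fact k \<le> (\<Sum>n. (1 + r) ^ n /\<^sub>R fact n)"
      using sum_le_suminf[OF summable_exp_generic[of "1 + r"], of "{k}"] r by simp
    then show ?thesis by (simp add: exp_def divide_inverse mult.commute)
  qed
  then have "(1 + r) ^ k \<le> fact k * exp (1 + r)" by (simp add: field_simps)
  then have "(1 + r) ^ k * exp (- (2 * a) * r\<^sup>2) \<le> fact k * exp (1 + r) * exp (- (2 * a) * r\<^sup>2)"
    by (intro mult_right_mono) auto
  also have "\<dots> = fact k * exp (1 + r - 2 * a * r\<^sup>2)" by (simp add: exp_diff exp_minus divide_inverse)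
  also have "1 + r - 2 * a * r\<^sup>2 \<le> 1 + 1 / (4 * a) - a * r\<^sup>2"
  proof -
    have "0 \<le> a * (r - 1 / (2 * a))\<^sup>2" using a by simp
    also have "\<dots> = a * r\<^sup>2 - r + 1 / (4 * a)"
      using a by (simp add: power2_eq_square field_simps)
    finally show ?thesis by simp
  qed
  then have "fact k * exp (1 + r - 2 * a * r\<^sup>2) \<le> fact k * exp (1 + 1 / (4 * a) - a * r\<^sup>2)" by simp
  also have "\<dots> = fact k * exp (1 + 1 / (4 * a)) * exp (- a * r\<^sup>2)"
    by (simp add: mult.assoc mult_exp_exp)
  finally show ?thesis .
qed

lemma integral_lborel_translate:
  fixes f :: "'a::euclidean_space \<Rightarrow> real"
  assumes "integrable lborel f"
  shows "integrable lborel (\<lambda>x. f (x + w))" "(\<integral>x. f (x + w) \<partial>lborel) = (\<integral>x. f x \<partial>lborel)"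
proof -
  have eq: "distr lborel borel (\<lambda>x. x + w) = (lborel :: 'a measure)"
    using lborel_distr_plus[of w] by (simp add: add.commute[of _ w])
  have m: "f \<in> borel_measurable borel" using borel_measurable_integrable[OF assms] by simp
  show "integrable lborel (\<lambda>x. f (x + w))"
    using assms by (subst (asm) eq[symmetric]) (simp add: integrable_distr_eq m)
  show "(\<integral>x. f (x + w) \<partial>lborel) = (\<integral>x. f x \<partial>lborel)"
    by (subst (2) eq[symmetric]) (simp add: integral_distr m)
qed

text \<open>The integral of \<open>\<phi>\<close> is invariant under translation by multiples of \<open>v\<close>;
  differentiate this under the integral sign.\<close>

lemma integral_directional_derivative_eq_0:
  fixes \<phi> :: "'a::euclidean_space \<Rightarrow> real"
  assumes der: "\<And>u. GDERIV \<phi> u :> \<phi>' u"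
    and bound: "\<And>u. \<bar>\<phi> u\<bar> \<le> K * exp (- a * (norm u)\<^sup>2)" "\<And>u. norm (\<phi>' u) \<le> K * exp (- a * (norm u)\<^sup>2)"
    and a: "0 < a"
  shows "(\<integral>u. \<phi>' u \<bullet> v \<partial>lborel) = 0"
proof -
  define s where "s n u = (\<phi> (u + inverse (real (Suc n)) *\<^sub>R v) - \<phi> u) / inverse (real (Suc n))" for n u
  have "continuous_on UNIV \<phi>"
    using der by (auto simp: continuous_on_eq_continuous_at gderiv_def intro: has_derivative_continuous)
  then have m[measurable]: "\<phi> \<in> borel_measurable borel" by (rule borel_measurable_continuous_onI)
  have int: "integrable lborel \<phi>"
    by (rule Bochner_Integration.integrable_bound[OF integrable_mult_right[OF integrable_exp_neg_norm_sq[OF a]], of _ K])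
      (use bound(1) in \<open>auto intro: order_trans[OF _ abs_ge_self]\<close>)
  have K: "0 \<le> K" using bound(1)[of 0] by simp
  have s0: "(\<integral>u. s n u \<partial>lborel) = 0" for n
    unfolding s_def using integral_lborel_translate[OF int] int by simp
  have lim: "(\<lambda>n. s n u) \<longlonglongrightarrow> \<phi>' u \<bullet> v" for u
  proof -
    have "DERIV (\<lambda>s. \<phi> (u + s *\<^sub>R v)) 0 :> \<phi>' u \<bullet> v"
      by (rule DERIV_along_line) (simp add: der)
    then have "((\<lambda>h. (\<phi> (u + h *\<^sub>R v) - \<phi> u) / h) \<longlongrightarrow> \<phi>' u \<bullet> v) (at 0)"
      by (simp add: DERIV_def)
    moreover have "filterlim (\<lambda>n. inverse (real (Suc n))) (at 0) sequentially"
      by (rule filterlim_atI[OF LIMSEQ_inverse_real_of_nat]) auto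
    ultimately show ?thesis unfolding s_def by (rule filterlim_compose)
  qed
  \<comment> \<open>By the mean value theorem the quotient is a derivative at a point within
    distance \<open>norm v\<close> of \<open>u\<close>. Half of the decay absorbs this shift, so the
    majorant does not depend on \<open>n\<close>.\<close>
  have dom: "norm (s n u) \<le> norm v * K * exp (a * (norm v)\<^sup>2) * exp (- (a / 2) * (norm u)\<^sup>2)" for n u
  proof -
    define e where "e = inverse (real (Suc n))"
    have e: "0 < e" "e \<le> 1" by (auto simp: e_def inverse_le_1_iff)
    have "\<exists>z>0. z < e \<and> \<phi> (u + e *\<^sub>R v) - \<phi> (u + 0 *\<^sub>R v) = (e - 0) * (\<phi>' (u + z *\<^sub>R v) \<bullet> v)"
      by (rule MVT2) (auto intro!: e DERIV_along_line der)
    then obtain z where z: "0 < z" "z < e" and eq: "\<phi> (u + e *\<^sub>R v) - \<phi> u = e * (\<phi>' (u + z *\<^sub>R v) \<bullet> v)"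
      by auto
    have "s n u = \<phi>' (u + z *\<^sub>R v) \<bullet> v"
      using eq e by (simp add: s_def e_def)
    then have "norm (s n u) \<le> norm v * norm (\<phi>' (u + z *\<^sub>R v))"
      using Cauchy_Schwarz_ineq2[of "\<phi>' (u + z *\<^sub>R v)" v] by (simp add: mult.commute)
    also have "\<dots> \<le> norm v * (K * exp (- a * (norm (u + z *\<^sub>R v))\<^sup>2))"
      by (intro mult_left_mono bound) simp
    also have "- a * (norm (u + z *\<^sub>R v))\<^sup>2 \<le> a * (norm v)\<^sup>2 + - (a / 2) * (norm u)\<^sup>2"
    proof -
      have "norm u \<le> norm (u + z *\<^sub>R v) + norm (z *\<^sub>R v)"
        using norm_triangle_ineq4[of "u + z *\<^sub>R v" "z *\<^sub>R v"] by simp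
      also have "norm (z *\<^sub>R v) \<le> norm v" using z e by (simp add: mult_left_le_one_le)
      finally have "(norm u)\<^sup>2 \<le> (norm (u + z *\<^sub>R v) + norm v)\<^sup>2" by (simp add: power_mono)
      also have "\<dots> \<le> 2 * (norm (u + z *\<^sub>R v))\<^sup>2 + 2 * (norm v)\<^sup>2"
        using sum_squares_bound[of "norm (u + z *\<^sub>R v)" "norm v"] by (simp add: power2_sum)
      finally have "(a / 2) * (norm u)\<^sup>2 \<le> (a / 2) * (2 * (norm (u + z *\<^sub>R v))\<^sup>2 + 2 * (norm v)\<^sup>2)"
        using a by (intro mult_left_mono) auto
      then show ?thesis by (simp add: algebra_simps)
    qed
    then have "norm v * (K * exp (- a * (norm (u + z *\<^sub>R v))\<^sup>2))
        \<le> norm v * (K * exp (a * (norm v)\<^sup>2 + - (a / 2) * (norm u)\<^sup>2))"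
      using K by (intro mult_left_mono) auto
    finally show ?thesis by (simp only: exp_add mult.assoc)
  qed
  have [measurable]: "s n \<in> borel_measurable lborel" for n unfolding s_def by measurable
  have [measurable]: "(\<lambda>u. \<phi>' u \<bullet> v) \<in> borel_measurable lborel"
    by (rule borel_measurable_LIMSEQ_real[where u = s]) (use lim in auto)
  have "integrable lborel (\<lambda>u::'a. norm v * K * exp (a * (norm v)\<^sup>2) * exp (- (a / 2) * (norm u)\<^sup>2))"
    using a by (intro integrable_mult_right integrable_exp_neg_norm_sq) auto
  then have "(\<lambda>n. \<integral>u. s n u \<partial>lborel) \<longlonglongrightarrow> (\<integral>u. \<phi>' u \<bullet> v \<partial>lborel)"
    by (rule integral_dominated_convergence[rotated 2]) (use lim dom in auto)
  then show ?thesis by (simp add: s0 LIMSEQ_const_iff)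
qed

text \<open>Total mass one is assumed rather than computed: \<open>P\<close> will be the law of a
  sample, so the Gaussian integral behind the normalising constant \<open>c\<close> is never
  evaluated.\<close>

locale gaussian_law = pos_def_op_bounds B lmin lmax
  for B :: "'a::euclidean_space \<Rightarrow> 'a" and lmin lmax +
  fixes c :: real and P :: "'a measure"
  assumes P_eq: "P = density lborel (\<lambda>u. ennreal (c * exp (- (u \<bullet> B u) / 2)))"
    and prob_space_P: "prob_space P"
begin

sublocale prob_space P by (rule prob_space_P)

lemma sets_P [measurable_cong, simp]: "sets P = sets borel" by (simp add: P_eq)

lemma space_P [simp]: "space P = UNIV" by (simp add: P_eq)

text \<open>Otherwise \<open>ennreal\<close> truncates the density to zero and the total mass
  vanishes.\<close>

lemma c_pos: "0 < c"
proof (rule ccontr)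
  assume "\<not> 0 < c"
  then have "ennreal (c * exp (- (u \<bullet> B u) / 2)) = 0" for u
    by (simp add: ennreal_neg mult_nonpos_nonneg)
  then have "emeasure P (space P) = 0" by (simp add: P_eq emeasure_density)
  then show False using emeasure_space_1 by simp
qed

lemma exp_B_le: "exp (- (u \<bullet> B u) / 2) \<le> exp (- (2 * (lmin / 4)) * (norm u)\<^sup>2)"
  using lmin_le[of u] by simp

lemma poly_exp_B_le:
  assumes "0 \<le> K" "0 \<le> b" "b \<le> K * (1 + norm u) ^ k"
  shows "exp (- (u \<bullet> B u) / 2) * b \<le> K * fact k * exp (1 + 1 / lmin) * exp (- (lmin / 4) * (norm u)\<^sup>2)"
proof -
  have "exp (- (u \<bullet> B u) / 2) * b \<le> exp (- (2 * (lmin / 4)) * (norm u)\<^sup>2) * (K * (1 + norm u) ^ k)"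
    using assms by (intro mult_mono exp_B_le) auto
  also have "\<dots> = K * ((1 + norm u) ^ k * exp (- (2 * (lmin / 4)) * (norm u)\<^sup>2))" by simp
  also have "\<dots> \<le> K * (fact k * exp (1 + 1 / (4 * (lmin / 4))) * exp (- (lmin / 4) * (norm u)\<^sup>2))"
    using assms lmin_pos by (intro mult_left_mono poly_times_exp_neg_sq_le) auto
  finally show ?thesis by (simp add: mult.assoc)
qed

lemma integrable_lborel_poly_growth:
  fixes g :: "'a \<Rightarrow> 'b::{banach, second_countable_topology}"
  assumes [measurable]: "g \<in> borel_measurable borel" and g: "\<And>u. norm (g u) \<le> K * (1 + norm u) ^ k"
  shows "integrable lborel (\<lambda>u. exp (- (u \<bullet> B u) / 2) *\<^sub>R g u)"
proof -
  have K: "0 \<le> K" using g[of 0] by simp (meson norm_ge_zero order_trans)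
  have "integrable lborel (\<lambda>u::'a. K * fact k * exp (1 + 1 / lmin) * exp (- (lmin / 4) * (norm u)\<^sup>2))"
    using lmin_pos by (intro integrable_mult_right integrable_exp_neg_norm_sq) auto
  then show ?thesis
  proof (rule Bochner_Integration.integrable_bound)
    show "AE u in lborel. norm (exp (- (u \<bullet> B u) / 2) *\<^sub>R g u)
        \<le> norm (K * fact k * exp (1 + 1 / lmin) * exp (- (lmin / 4) * (norm u)\<^sup>2))"
      using poly_exp_B_le[OF K norm_ge_zero g] K by (intro AE_I2) (simp add: abs_mult)
  qed simp
qed

lemma integrable_poly_growth:
  fixes g :: "'a \<Rightarrow> 'b::{banach, second_countable_topology}"
  assumes [measurable]: "g \<in> borel_measurable borel" and g: "\<And>u. norm (g u) \<le> K * (1 + norm u) ^ k"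
  shows "integrable P g"
proof -
  have "integrable lborel (\<lambda>u. c *\<^sub>R (exp (- (u \<bullet> B u) / 2) *\<^sub>R g u))"
    by (intro integrable_scaleR_right integrable_lborel_poly_growth[OF _ g]) simp
  then show ?thesis
    unfolding P_eq using c_pos by (subst integrable_density) auto
qed

lemma expectation_eq:
  fixes g :: "'a \<Rightarrow> real"
  assumes [measurable]: "g \<in> borel_measurable borel"
  shows "expectation g = c * (\<integral>u. exp (- (u \<bullet> B u) / 2) * g u \<partial>lborel)"
proof -
  have "expectation g = (\<integral>u. (c * exp (- (u \<bullet> B u) / 2)) *\<^sub>R g u \<partial>lborel)"
    unfolding P_eq by (rule integral_density) (use c_pos in simp_all)
  also have "\<dots> = (\<integral>u. c * (exp (- (u \<bullet> B u) / 2) * g u) \<partial>lborel)"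
    by (simp only: real_scaleR_def mult.assoc)
  also have "\<dots> = c * (\<integral>u. exp (- (u \<bullet> B u) / 2) * g u \<partial>lborel)"
    by (rule integral_mult_right_zero)
  finally show ?thesis .
qed

text \<open>The gradient of the Gaussian weight \<open>E\<close> times \<open>g\<close> is
  \<open>E u *\<^sub>R (g' u - g u *\<^sub>R B u)\<close>, and its integral in direction
  \<open>v\<close> vanishes; polynomial growth allows the two terms to be integrated
  separately.\<close>

lemma Stein:
  assumes der: "\<And>u. GDERIV g u :> g' u" and [measurable]: "g' \<in> borel_measurable borel"
    and g: "\<And>u. \<bar>g u\<bar> \<le> K * (1 + norm u) ^ k" and g': "\<And>u. norm (g' u) \<le> K * (1 + norm u) ^ k"
  shows "expectation (\<lambda>u. g' u \<bullet> v) = expectation (\<lambda>u. g u * (B u \<bullet> v))"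
proof -
  have "continuous_on UNIV g"
    using der by (auto simp: continuous_on_eq_continuous_at gderiv_def intro: has_derivative_continuous)
  then have [measurable]: "g \<in> borel_measurable borel" by (rule borel_measurable_continuous_onI)
  have K: "0 \<le> K" using g[of 0] by simp
  define E where "E u = exp (- (u \<bullet> B u) / 2)" for u
  \<comment> \<open>The degree rises to \<open>Suc k\<close> because the term
    \<open>g u *\<^sub>R B u\<close> grows one degree faster than \<open>g\<close>.\<close>
  define K' where "K' = (K + K * lmax) * fact (Suc k) * exp (1 + 1 / lmin)"
  have K': "0 \<le> K + K * lmax" using K lmax_pos by simp
  have mono: "K * (1 + norm u) ^ k \<le> K * (1 + norm u) ^ Suc k" for u :: 'a
    using K by (intro mult_left_mono power_increasing) auto
  have gB: "norm (g u *\<^sub>R B u) \<le> K * lmax * (1 + norm u) ^ Suc k" for u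
  proof -
    have "norm (g u *\<^sub>R B u) \<le> (K * (1 + norm u) ^ k) * (lmax * (1 + norm u))"
      unfolding norm_scaleR
      using norm_B_le[of u] K lmax_pos by (intro mult_mono g) (auto simp: algebra_simps)
    then show ?thesis by (simp add: algebra_simps)
  qed
  have "(\<integral>u. (E u *\<^sub>R (g' u - g u *\<^sub>R B u)) \<bullet> v \<partial>lborel) = 0"
  proof (rule integral_directional_derivative_eq_0)
    show "GDERIV (\<lambda>u. E u * g u) u :> E u *\<^sub>R (g' u - g u *\<^sub>R B u)" for u
    proof -
      have B: "(B has_derivative B) (at u)"
        using lin by (simp add: linear_imp_has_derivative)
      have "((\<lambda>u. u \<bullet> B u) has_derivative (\<lambda>h. u \<bullet> B h + h \<bullet> B u)) (at u)"
        by (rule has_derivative_inner) (auto intro: B)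
      from has_derivative_mult_right[OF this, of "- 1 / 2"]
      have "((\<lambda>u. - (u \<bullet> B u) / 2) has_derivative (\<lambda>h. h \<bullet> (- B u))) (at u)"
        by (simp add: inner_B_commute field_simps)
      from has_derivative_exp[OF this]
      have "((\<lambda>u. E u) has_derivative (\<lambda>h. E u * (h \<bullet> (- B u)))) (at u)"
        by (simp add: E_def mult.commute)
      from has_derivative_mult[OF this der[of u, unfolded gderiv_def]]
      show ?thesis
        unfolding gderiv_def
        by (rule has_derivative_eq_rhs) (simp add: inner_diff_right fun_eq_iff algebra_simps)
    qed
    show "\<bar>E u * g u\<bar> \<le> K' * exp (- (lmin / 4) * (norm u)\<^sup>2)" for u
    proof -
      have "\<bar>g u\<bar> \<le> K * (1 + norm u) ^ Suc k" using g[of u] mono[of u] by simp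
      also have "\<dots> \<le> (K + K * lmax) * (1 + norm u) ^ Suc k"
        using K lmax_pos by (intro mult_right_mono) auto
      finally have "E u * \<bar>g u\<bar> \<le> K' * exp (- (lmin / 4) * (norm u)\<^sup>2)"
        unfolding E_def K'_def by (intro poly_exp_B_le K') auto
      then show ?thesis by (simp add: abs_mult E_def)
    qed
    show "norm (E u *\<^sub>R (g' u - g u *\<^sub>R B u)) \<le> K' * exp (- (lmin / 4) * (norm u)\<^sup>2)" for u
    proof -
      have "norm (g' u - g u *\<^sub>R B u) \<le> K * (1 + norm u) ^ Suc k + K * lmax * (1 + norm u) ^ Suc k"
        using norm_triangle_ineq4[of "g' u" "g u *\<^sub>R B u"] g'[of u] mono[of u] gB[of u] by linarith
      then have "norm (g' u - g u *\<^sub>R B u) \<le> (K + K * lmax) * (1 + norm u) ^ Suc k"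
        by (simp add: distrib_right)
      then have "E u * norm (g' u - g u *\<^sub>R B u) \<le> K' * exp (- (lmin / 4) * (norm u)\<^sup>2)"
        unfolding E_def K'_def by (intro poly_exp_B_le K') auto
      then show ?thesis by (simp add: E_def)
    qed
    show "0 < lmin / 4" using lmin_pos by simp
  qed
  moreover have "(E u *\<^sub>R (g' u - g u *\<^sub>R B u)) \<bullet> v = E u * (g' u \<bullet> v) - E u * (g u * (B u \<bullet> v))" for u
    by (simp add: inner_diff_left algebra_simps)
  moreover have "integrable lborel (\<lambda>u. E u * (g' u \<bullet> v))"
  proof -
    have "integrable lborel (\<lambda>u. (E u *\<^sub>R g' u) \<bullet> v)"
      unfolding E_def by (intro integrable_inner_left integrable_lborel_poly_growth[OF _ g']) simp
    then show ?thesis by simp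
  qed
  moreover have "integrable lborel (\<lambda>u. E u * (g u * (B u \<bullet> v)))"
  proof -
    have "integrable lborel (\<lambda>u. (E u *\<^sub>R (g u *\<^sub>R B u)) \<bullet> v)"
      unfolding E_def by (intro integrable_inner_left integrable_lborel_poly_growth[OF _ gB]) simp
    then show ?thesis by (simp add: mult.assoc)
  qed
  ultimately have "(\<integral>u. E u * (g' u \<bullet> v) \<partial>lborel) = (\<integral>u. E u * (g u * (B u \<bullet> v)) \<partial>lborel)"
    by simp
  then show ?thesis by (simp add: expectation_eq E_def)
qed

lemma integrable_quadratic: "integrable P (\<lambda>u. u \<bullet> B u)"
proof (rule integrable_poly_growth)
  show "norm (u \<bullet> B u) \<le> lmax * (1 + norm u) ^ 2" for u
    using order_trans[OF le_lmax[of u] mult_left_mono[OF power_mono[of "norm u" "1 + norm u" 2]]]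
      nonneg[of u] lmax_pos by simp
qed simp

text \<open>\<open>Stein\<close> for the coordinate function \<open>u \<bullet> b\<close> in its own
  direction gives the value 1 for each basis vector. Summation yields the trace without computing a
  covariance matrix.\<close>

lemma expectation_quadratic: "expectation (\<lambda>u. u \<bullet> B u) = DIM('a)"
proof -
  have gr: "norm (u \<bullet> b) \<le> 1 * (1 + norm u) ^ 1" "norm b \<le> 1 * (1 + norm u) ^ 1"
    if "b \<in> Basis" for u b :: 'a
    using that Basis_le_norm[of b u] by auto
  have st: "expectation (\<lambda>u. b \<bullet> b) = expectation (\<lambda>u. (u \<bullet> b) * (B u \<bullet> b))" if b: "b \<in> Basis" for b
  proof (rule Stein[where k = 1 and K = 1])
    show "GDERIV (\<lambda>u. u \<bullet> b) u :> b" for u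
      unfolding gderiv_def by (auto intro!: derivative_eq_intros)
  qed (use gr[OF b] in auto)
  have int: "integrable P (\<lambda>u. (u \<bullet> b) * (B u \<bullet> b))" if b: "b \<in> Basis" for b
  proof (rule integrable_poly_growth)
    show "norm ((u \<bullet> b) * (B u \<bullet> b)) \<le> lmax * (1 + norm u) ^ 2" for u
    proof -
      have "norm ((u \<bullet> b) * (B u \<bullet> b)) \<le> (1 + norm u) * (lmax * (1 + norm u))"
        unfolding norm_mult
        using Basis_le_norm[OF b, of u] Basis_le_norm[OF b, of "B u"] norm_B_le[of u] lmax_pos
        by (intro mult_mono) (auto simp: algebra_simps)
      then show ?thesis by (simp add: power2_eq_square algebra_simps)
    qed
  qed simp
  have "expectation (\<lambda>u. u \<bullet> B u) = expectation (\<lambda>u. \<Sum>b\<in>Basis. (u \<bullet> b) * (B u \<bullet> b))"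
    by (intro Bochner_Integration.integral_cong refl euclidean_inner)
  also have "\<dots> = (\<Sum>b\<in>Basis. expectation (\<lambda>u. (u \<bullet> b) * (B u \<bullet> b)))"
    by (rule Bochner_Integration.integral_sum) (rule int)
  also have "\<dots> = (\<Sum>b\<in>(Basis::'a set). 1)"
    by (rule sum.cong) (simp_all add: st[symmetric] prob_space del: space_P)
  finally show ?thesis by simp
qed

text \<open>Nonnegativity of the variance bounds the squared mean by the second moment, which is the
  dimension.\<close>

lemma expectation_wnorm_le:
  "integrable P (wnorm B)" "expectation (wnorm B) \<le> sqrt DIM('a)"
proof -
  have int2: "integrable P (\<lambda>u. (wnorm B u)\<^sup>2)"
    by (simp add: wnorm_sq integrable_quadratic)
  show int: "integrable P (wnorm B)"
    by (rule square_integrable_imp_integrable[OF _ int2]) simp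
  have "0 \<le> expectation (\<lambda>u. (wnorm B u - expectation (wnorm B))\<^sup>2)" by simp
  also have "\<dots> = expectation (\<lambda>u. (wnorm B u)\<^sup>2) - (expectation (wnorm B))\<^sup>2"
    by (rule variance_eq[OF int int2])
  finally have "(expectation (wnorm B))\<^sup>2 \<le> DIM('a)"
    by (simp add: wnorm_sq expectation_quadratic)
  then show "expectation (wnorm B) \<le> sqrt DIM('a)" by (rule real_le_rsqrt)
qed

end

subsection \<open>Gaussian smoothing\<close>

text \<open>\<open>J\<close> stands for the reflection \<open>(x, y) \<mapsto> (x, - y)\<close>, which turns gradients into saddle operators.\<close>

locale smoothing = gaussian_law B lmin lmax c P
  for B :: "'a::euclidean_space \<Rightarrow> 'a" and lmin lmax c P +
  fixes f :: "'a \<Rightarrow> real" and f' J :: "'a \<Rightarrow> 'a" and L \<mu> :: real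
  assumes der: "GDERIV f w :> f' w"
    and Lipschitz: "wnorm_dual B (f' v - f' w) \<le> L * wnorm B (v - w)"
    and L_nonneg: "0 \<le> L" and mu_pos: "0 < \<mu>"
    and linear_J: "linear J" and norm_J: "norm (J x) = norm x"
    and wnorm_dual_J: "wnorm_dual B (J x) = wnorm_dual B x"
begin

definition F :: "'a \<Rightarrow> 'a" where
  "F w = J (f' w)"

text \<open>Written as the reflected mean gradient, which makes Lipschitz and bias estimates
  immediate; \<open>GDERIV_smoothing\<close> identifies the mean with the gradient of the smoothed
  function.\<close>

definition F\<mu> :: "'a \<Rightarrow> 'a" where
  "F\<mu> w = J (\<integral>u. f' (w + \<mu> *\<^sub>R u) \<partial>P)"

definition G :: "'a \<Rightarrow> 'a \<Rightarrow> 'a" where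
  "G w u = ((f (w + \<mu> *\<^sub>R u) - f w) / \<mu>) *\<^sub>R J (B u)"

lemma bounded_linear_J: "bounded_linear J"
  using linear_J by (simp add: linear_conv_bounded_linear)

lemma continuous_on_J [continuous_intros]: "continuous_on S g \<Longrightarrow> continuous_on S (\<lambda>x. J (g x))"
  by (rule bounded_linear.continuous_on[OF bounded_linear_J])

lemma measurable_J [measurable]: "J \<in> borel_measurable borel"
  by (intro borel_measurable_continuous_onI continuous_intros)

lemma norm_f'_diff_le: "norm (f' v - f' w) \<le> L * lmax * norm (v - w)"
proof -
  have "norm (f' v - f' w) \<le> sqrt lmax * wnorm_dual B (f' v - f' w)" by (rule norm_le_wnorm_dual)
  also have "\<dots> \<le> sqrt lmax * (L * (sqrt lmax * norm (v - w)))"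
    using lmax_pos L_nonneg
    by (intro mult_left_mono order_trans[OF Lipschitz] wnorm_le_norm) auto
  also have "\<dots> = L * lmax * norm (v - w)" using lmax_pos by (simp add: mult.left_commute flip: mult.assoc)
  finally show ?thesis .
qed

lemma continuous_f': "continuous_on UNIV f'"
proof (rule lipschitz_on_continuous_on)
  show "(L * lmax)-lipschitz_on UNIV f'"
    using norm_f'_diff_le L_nonneg lmax_pos by (auto simp: lipschitz_on_def dist_norm)
qed

lemma continuous_f: "continuous_on UNIV f"
  using der by (auto simp: continuous_on_eq_continuous_at gderiv_def intro: has_derivative_continuous)

lemma measurable_f [measurable]: "f \<in> borel_measurable borel"
  by (rule borel_measurable_continuous_onI[OF continuous_f])

lemma measurable_f' [measurable]: "f' \<in> borel_measurable borel"
  by (rule borel_measurable_continuous_onI[OF continuous_f'])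

lemma measurable_G [measurable]: "(\<lambda>(w, u). G w u) \<in> borel_measurable (borel \<Otimes>\<^sub>M borel)"
  unfolding G_def by measurable

text \<open>The remainder is a gradient difference at an intermediate point. The constant is twice
  the sharp one, which is harmless: it serves growth bounds and differentiability and does not reach
  the rate.\<close>

lemma Taylor: "\<bar>f y - f x - f' x \<bullet> (y - x)\<bar> \<le> L * lmax * (norm (y - x))\<^sup>2"
proof -
  have "\<exists>z>0. z < 1 \<and> f (x + 1 *\<^sub>R (y - x)) - f (x + 0 *\<^sub>R (y - x)) = (1 - 0) * (f' (x + z *\<^sub>R (y - x)) \<bullet> (y - x))"
    by (rule MVT2) (auto intro!: DERIV_along_line der)
  then obtain z where z: "0 < z" "z < 1" and eq: "f y - f x = f' (x + z *\<^sub>R (y - x)) \<bullet> (y - x)"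
    by auto
  have "\<bar>f y - f x - f' x \<bullet> (y - x)\<bar> = \<bar>(f' (x + z *\<^sub>R (y - x)) - f' x) \<bullet> (y - x)\<bar>"
    by (simp add: eq inner_diff_left)
  also have "\<dots> \<le> norm (f' (x + z *\<^sub>R (y - x)) - f' x) * norm (y - x)"
    by (rule Cauchy_Schwarz_ineq2)
  also have "norm (f' (x + z *\<^sub>R (y - x)) - f' x) \<le> L * lmax * norm (y - x)"
  proof -
    have "norm (f' (x + z *\<^sub>R (y - x)) - f' x) \<le> L * lmax * norm (z *\<^sub>R (y - x))"
      using norm_f'_diff_le[of "x + z *\<^sub>R (y - x)" x] by simp
    also have "\<dots> \<le> L * lmax * norm (y - x)"
      using z L_nonneg lmax_pos by (intro mult_left_mono) (auto simp: mult_left_le_one_le)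
    finally show ?thesis .
  qed
  finally show ?thesis by (simp add: mult_right_mono power2_eq_square mult.assoc)
qed

text \<open>One constant and one degree for function and gradient together, as \<open>Stein\<close>
  requires.\<close>

lemma growth:
  obtains K where "0 \<le> K" "\<And>u. \<bar>f (w + \<mu> *\<^sub>R u) - f w\<bar> \<le> K * (1 + norm u) ^ 2"
    "\<And>u. norm (f' (w + \<mu> *\<^sub>R u)) \<le> K * (1 + norm u) ^ 2"
proof -
  define K where "K = (norm (f' w) + L * lmax * \<mu>) * (1 + \<mu>)"
  have 0: "0 \<le> norm (f' w)" "0 \<le> L * lmax * \<mu>" using L_nonneg lmax_pos mu_pos by auto
  have grad: "norm (f' (w + \<mu> *\<^sub>R u)) \<le> (norm (f' w) + L * lmax * \<mu>) * (1 + norm u)" for u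
  proof -
    have "norm (f' (w + \<mu> *\<^sub>R u)) \<le> norm (f' w) + norm (f' (w + \<mu> *\<^sub>R u) - f' w)"
      using norm_triangle_ineq[of "f' w" "f' (w + \<mu> *\<^sub>R u) - f' w"] by simp
    also have "\<dots> \<le> norm (f' w) + L * lmax * norm (\<mu> *\<^sub>R u)"
      using norm_f'_diff_le[of "w + \<mu> *\<^sub>R u" w] by simp
    also have "\<dots> \<le> (norm (f' w) + L * lmax * \<mu>) * (1 + norm u)"
      using 0 mu_pos by (simp add: algebra_simps)
    finally show ?thesis .
  qed
  have sq: "x \<le> x\<^sup>2" if "1 \<le> x" for x :: real
    using that by (simp add: power2_eq_square)
  show ?thesis
  proof
    show "0 \<le> K" using 0 mu_pos by (simp add: K_def)
    show "norm (f' (w + \<mu> *\<^sub>R u)) \<le> K * (1 + norm u) ^ 2" for u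
    proof -
      have "(norm (f' w) + L * lmax * \<mu>) * (1 + norm u) \<le> K * (1 + norm u) ^ 2"
      proof (intro mult_mono sq)
        show "norm (f' w) + L * lmax * \<mu> \<le> K"
          unfolding K_def distrib_left using 0 mu_pos by simp
        show "0 \<le> K" unfolding K_def using 0 mu_pos by simp
      qed auto
      then show ?thesis using grad[of u] by simp
    qed
    show "\<bar>f (w + \<mu> *\<^sub>R u) - f w\<bar> \<le> K * (1 + norm u) ^ 2" for u
    proof -
      have "\<bar>f (w + \<mu> *\<^sub>R u) - f w\<bar> \<le> \<bar>f' w \<bullet> (\<mu> *\<^sub>R u)\<bar> + L * lmax * (norm (\<mu> *\<^sub>R u))\<^sup>2"
        using Taylor[of "w + \<mu> *\<^sub>R u" w] by simp
      also have "\<dots> \<le> norm (f' w) * norm (\<mu> *\<^sub>R u) + L * lmax * (norm (\<mu> *\<^sub>R u))\<^sup>2"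
        using Cauchy_Schwarz_ineq2[of "f' w" "\<mu> *\<^sub>R u"] by simp
      also have "\<dots> = norm (f' w) * \<mu> * norm u + (L * lmax * \<mu>) * \<mu> * (norm u)\<^sup>2"
        using mu_pos by (simp add: power_mult_distrib power2_eq_square algebra_simps)
      also have "\<dots> \<le> norm (f' w) * (1 + \<mu>) * (1 + norm u)\<^sup>2 + (L * lmax * \<mu>) * (1 + \<mu>) * (1 + norm u)\<^sup>2"
      proof (intro add_mono mult_mono)
        show "norm u \<le> (1 + norm u)\<^sup>2" by (simp add: power2_eq_square algebra_simps)
      qed (use 0 mu_pos L_nonneg lmax_pos in \<open>auto intro!: power_mono\<close>)
      finally show ?thesis by (simp add: K_def algebra_simps)
    qed
  qed
qed

lemma integrable_f: "integrable P (\<lambda>u. f (w + \<mu> *\<^sub>R u))"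
proof -
  obtain K where K: "\<And>u. \<bar>f (w + \<mu> *\<^sub>R u) - f w\<bar> \<le> K * (1 + norm u) ^ 2"
    using growth by metis
  have "integrable P (\<lambda>u. f (w + \<mu> *\<^sub>R u) - f w)"
    by (rule integrable_poly_growth) (use K in auto)
  from Bochner_Integration.integrable_add[OF this integrable_const[of "f w"]]
  show ?thesis by simp
qed

lemma integrable_f': "integrable P (\<lambda>u. f' (w + \<mu> *\<^sub>R u))"
proof -
  obtain K where "\<And>u. norm (f' (w + \<mu> *\<^sub>R u)) \<le> K * (1 + norm u) ^ 2"
    using growth by metis
  then show ?thesis by (rule integrable_poly_growth[rotated]) simp
qed

text \<open>The bound on the Taylor remainder is the same for every \<open>u\<close>, so it survives
  averaging and gives the derivative directly from its definition.\<close>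

lemma GDERIV_smoothing:
  "GDERIV (\<lambda>w. \<integral>u. f (w + \<mu> *\<^sub>R u) \<partial>P) w :> (\<integral>u. f' (w + \<mu> *\<^sub>R u) \<partial>P)"
proof -
  define f1 where "f1 w = (\<integral>u. f (w + \<mu> *\<^sub>R u) \<partial>P)" for w
  define g where "g = (\<integral>u. f' (w + \<mu> *\<^sub>R u) \<partial>P)"
  have rem: "\<bar>f1 y - f1 w - (y - w) \<bullet> g\<bar> \<le> L * lmax * (norm (y - w))\<^sup>2" for y
  proof -
    have "f1 y - f1 w - (y - w) \<bullet> g
        = (\<integral>u. f (y + \<mu> *\<^sub>R u) - f (w + \<mu> *\<^sub>R u) - (y - w) \<bullet> f' (w + \<mu> *\<^sub>R u) \<partial>P)"
      by (simp add: f1_def g_def integrable_f integrable_f')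
    also have "\<bar>\<dots>\<bar> \<le> (\<integral>u. L * lmax * (norm (y - w))\<^sup>2 \<partial>P)"
      unfolding real_norm_def[symmetric]
    proof (rule Bochner_Integration.integral_norm_bound_integral)
      show "integrable P (\<lambda>u. f (y + \<mu> *\<^sub>R u) - f (w + \<mu> *\<^sub>R u) - (y - w) \<bullet> f' (w + \<mu> *\<^sub>R u))"
        by (simp add: integrable_f integrable_f')
      show "norm (f (y + \<mu> *\<^sub>R u) - f (w + \<mu> *\<^sub>R u) - (y - w) \<bullet> f' (w + \<mu> *\<^sub>R u))
          \<le> L * lmax * (norm (y - w))\<^sup>2" for u
        using Taylor[of "y + \<mu> *\<^sub>R u" "w + \<mu> *\<^sub>R u"] by (simp add: inner_commute)
    qed simp
    also have "\<dots> = L * lmax * (norm (y - w))\<^sup>2" using prob_space by simp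
    finally show ?thesis .
  qed
  have "((\<lambda>y. norm (f1 y - f1 w - (y - w) \<bullet> g) / norm (y - w)) \<longlongrightarrow> 0) (at w)"
  proof (rule Lim_null_comparison)
    show "\<forall>\<^sub>F y in at w. norm (norm (f1 y - f1 w - (y - w) \<bullet> g) / norm (y - w)) \<le> L * lmax * norm (y - w)"
      unfolding eventually_at_topological
      using rem by (auto intro!: exI[of _ UNIV] simp: divide_le_eq power2_eq_square mult.assoc)
    have "((\<lambda>y. L * lmax * norm (y - w)) \<longlongrightarrow> L * lmax * norm (w - w)) (at w)"
      by (intro tendsto_intros)
    then show "((\<lambda>y. L * lmax * norm (y - w)) \<longlongrightarrow> 0) (at w)" by simp
  qed
  then show ?thesis
    unfolding gderiv_def f1_def[symmetric] g_def[symmetric] has_derivative_iff_norm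
    by (simp add: bounded_linear_inner_left)
qed

text \<open>Pairing the mean \<open>e\<close> with \<open>inv B e\<close> turns its squared norm
  into a scalar integral; Cauchy-Schwarz under the integral and division by the norm of
  \<open>e\<close> finish.\<close>

lemma wnorm_dual_integral_le:
  assumes X: "integrable P X" and Y: "integrable P Y" and le: "\<And>u. wnorm_dual B (X u) \<le> Y u"
  shows "wnorm_dual B (\<integral>u. X u \<partial>P) \<le> (\<integral>u. Y u \<partial>P)"
proof -
  define e where "e = (\<integral>u. X u \<partial>P)"
  have "(wnorm_dual B e)\<^sup>2 = (\<integral>u. X u \<bullet> inv B e \<partial>P)"
    using X by (simp add: dual.wnorm_sq e_def)
  also have "\<dots> \<le> (\<integral>u. Y u * wnorm_dual B e \<partial>P)"
  proof (rule integral_mono)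
    show "X u \<bullet> inv B e \<le> Y u * wnorm_dual B e" for u
      using dual.Cauchy_Schwarz_wnorm[of "X u" e] mult_right_mono[OF le[of u] dual.wnorm_nonneg[of e]] by simp
  qed (use X Y in auto)
  also have "\<dots> = (\<integral>u. Y u \<partial>P) * wnorm_dual B e" by simp
  finally have *: "wnorm_dual B e * wnorm_dual B e \<le> (\<integral>u. Y u \<partial>P) * wnorm_dual B e"
    by (simp add: power2_eq_square)
  have "0 \<le> (\<integral>u. Y u \<partial>P)"
    by (rule Bochner_Integration.integral_nonneg) (use le dual.wnorm_nonneg order_trans in blast)
  then show ?thesis
    using * dual.wnorm_nonneg[of e] unfolding e_def[symmetric]
    by (cases "wnorm_dual B e = 0") auto
qed

lemma wnorm_dual_J_diff: "wnorm_dual B (J x - J y) = wnorm_dual B (x - y)"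
  by (metis linear_diff[OF linear_J] wnorm_dual_J)

lemma F_Lipschitz: "wnorm_dual B (F v - F w) \<le> L * wnorm B (v - w)"
  by (simp add: F_def wnorm_dual_J_diff Lipschitz)

lemma F\<mu>_Lipschitz: "wnorm_dual B (F\<mu> v - F\<mu> w) \<le> L * wnorm B (v - w)"
proof -
  have "wnorm_dual B (F\<mu> v - F\<mu> w) = wnorm_dual B (\<integral>u. f' (v + \<mu> *\<^sub>R u) - f' (w + \<mu> *\<^sub>R u) \<partial>P)"
    by (simp add: F\<mu>_def wnorm_dual_J_diff integrable_f')
  also have "\<dots> \<le> (\<integral>u. L * wnorm B (v - w) \<partial>P)"
  proof (rule wnorm_dual_integral_le)
    show "wnorm_dual B (f' (v + \<mu> *\<^sub>R u) - f' (w + \<mu> *\<^sub>R u)) \<le> L * wnorm B (v - w)" for u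
      using Lipschitz[of "v + \<mu> *\<^sub>R u" "w + \<mu> *\<^sub>R u"] by simp
  qed (use integrable_f' in auto)
  finally show ?thesis using prob_space by simp
qed

lemma smoothing_bias: "wnorm_dual B (F\<mu> w - F w) \<le> \<mu> * L * sqrt DIM('a)"
proof -
  have "wnorm_dual B (F\<mu> w - F w) = wnorm_dual B (\<integral>u. f' (w + \<mu> *\<^sub>R u) - f' w \<partial>P)"
    using prob_space by (simp add: F\<mu>_def F_def wnorm_dual_J_diff integrable_f')
  also have "\<dots> \<le> (\<integral>u. \<mu> * L * wnorm B u \<partial>P)"
  proof (rule wnorm_dual_integral_le)
    show "wnorm_dual B (f' (w + \<mu> *\<^sub>R u) - f' w) \<le> \<mu> * L * wnorm B u" for u
      using Lipschitz[of "w + \<mu> *\<^sub>R u" w] mu_pos by (simp add: wnorm_scale mult.left_commute mult.assoc)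
  qed (use integrable_f' expectation_wnorm_le(1) in auto)
  also have "\<dots> = \<mu> * L * expectation (wnorm B)" by simp
  also have "\<dots> \<le> \<mu> * L * sqrt DIM('a)"
    using expectation_wnorm_le(2) mu_pos L_nonneg by (intro mult_left_mono) auto
  finally show ?thesis .
qed

lemma G_growth:
  obtains K where "0 \<le> K" "\<And>u. norm (G w u) \<le> K * (1 + norm u) ^ 3"
proof -
  obtain K where K: "0 \<le> K" "\<And>u. \<bar>f (w + \<mu> *\<^sub>R u) - f w\<bar> \<le> K * (1 + norm u) ^ 2"
    using growth by metis
  show ?thesis
  proof
    show "norm (G w u) \<le> (K / \<mu> * lmax) * (1 + norm u) ^ 3" for u
    proof -
      have "norm (G w u) = \<bar>f (w + \<mu> *\<^sub>R u) - f w\<bar> / \<mu> * norm (B u)"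
        using mu_pos by (simp add: G_def norm_J)
      also have "\<dots> \<le> (K * (1 + norm u) ^ 2) / \<mu> * (lmax * (1 + norm u))"
        using K mu_pos lmax_pos norm_B_le[of u]
        by (intro mult_mono divide_right_mono) (auto simp: algebra_simps)
      also have "\<dots> = (K / \<mu> * lmax) * (1 + norm u) ^ 3" by (simp add: power3_eq_cube power2_eq_square)
      finally show ?thesis .
    qed
    show "0 \<le> K / \<mu> * lmax" using K mu_pos lmax_pos by simp
  qed
qed

lemma measurable_G_right [measurable]: "G w \<in> borel_measurable borel"
  unfolding G_def by measurable

lemma integrable_G: "integrable P (G w)"
  by (metis G_growth integrable_poly_growth measurable_G_right)

text \<open>The integral of a nonintegrable function is 0 by convention, so a bound on the second
  moment is informative only together with this fact. The degree 6 is twice the cubic growth of the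
  oracle.\<close>

lemma integrable_wnorm_dual_sq: "integrable P (\<lambda>u. (wnorm_dual B (G w u - e))\<^sup>2)"
proof -
  obtain K where K: "0 \<le> K" "\<And>u. norm (G w u) \<le> K * (1 + norm u) ^ 3"
    using G_growth by metis
  show ?thesis
  proof (rule integrable_poly_growth)
    show "norm ((wnorm_dual B (G w u - e))\<^sup>2) \<le> (K + norm e)\<^sup>2 / lmin * (1 + norm u) ^ 6" for u
    proof -
      have "sqrt lmin * wnorm_dual B (G w u - e) \<le> norm (G w u - e)" by (rule wnorm_dual_le_norm)
      also have "\<dots> \<le> norm (G w u) + norm e" by (rule norm_triangle_ineq4)
      also have "\<dots> \<le> K * (1 + norm u) ^ 3 + norm e * (1 + norm u) ^ 3"
        using K by (intro add_mono) (auto simp: mult_le_cancel_left1)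
      also have "\<dots> = (K + norm e) * (1 + norm u) ^ 3" by (simp add: algebra_simps)
      finally have "(sqrt lmin * wnorm_dual B (G w u - e))\<^sup>2 \<le> ((K + norm e) * (1 + norm u) ^ 3)\<^sup>2"
        using lmin_pos dual.wnorm_nonneg by (intro power_mono) auto
      then show ?thesis
        using lmin_pos
        by (simp add: power_mult_distrib pos_le_divide_eq mult.commute[of _ lmin] flip: power_mult)
    qed
    show "(\<lambda>u. (wnorm_dual B (G w u - e))\<^sup>2) \<in> borel_measurable borel"
      using dual.measurable_wnorm by measurable
  qed
qed

text \<open>\<open>Stein\<close> is applied to the difference quotient as a function of
  \<open>u\<close>: the factor \<open>\<mu>\<close> of the chain rule cancels its denominator, so
  its gradient is \<open>f' (w + \<mu> *\<^sub>R u)\<close>. The reflection is linear and leaves the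
  integral.\<close>

lemma oracle_unbiased: "(\<integral>u. G w u \<partial>P) = F\<mu> w"
proof -
  define G0 where "G0 u = ((f (w + \<mu> *\<^sub>R u) - f w) / \<mu>) *\<^sub>R B u" for u
  obtain K where K: "0 \<le> K" "\<And>u. \<bar>f (w + \<mu> *\<^sub>R u) - f w\<bar> \<le> K * (1 + norm u) ^ 2"
    "\<And>u. norm (f' (w + \<mu> *\<^sub>R u)) \<le> K * (1 + norm u) ^ 2"
    using growth by metis
  have G_J: "G w u = J (G0 u)" for u
    by (simp add: G_def G0_def linear_scale[OF linear_J])
  have J_inj: "norm (G0 u) = norm (G w u)" for u
    by (simp add: G_J norm_J)
  have int0: "integrable P G0"
  proof -
    obtain K where K: "\<And>u. norm (G w u) \<le> K * (1 + norm u) ^ 3"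
      using G_growth by metis
    show ?thesis
    proof (rule integrable_poly_growth)
      show "norm (G0 u) \<le> K * (1 + norm u) ^ 3" for u using K by (simp add: J_inj)
    qed (simp add: G0_def[abs_def])
  qed
  have inner_eq: "(\<integral>u. G0 u \<partial>P) \<bullet> b = (\<integral>u. f' (w + \<mu> *\<^sub>R u) \<partial>P) \<bullet> b" for b
  proof -
    have "expectation (\<lambda>u. f' (w + \<mu> *\<^sub>R u) \<bullet> b) = expectation (\<lambda>u. ((f (w + \<mu> *\<^sub>R u) - f w) / \<mu>) * (B u \<bullet> b))"
    proof (rule Stein)
      show "GDERIV (\<lambda>u. (f (w + \<mu> *\<^sub>R u) - f w) / \<mu>) u :> f' (w + \<mu> *\<^sub>R u)" for u
      proof -
        have "((\<lambda>u. w + \<mu> *\<^sub>R u) has_derivative (\<lambda>h. \<mu> *\<^sub>R h)) (at u)"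
          by (auto intro!: derivative_eq_intros)
        from has_derivative_compose[OF this der[unfolded gderiv_def]]
        have 1: "((\<lambda>u. f (w + \<mu> *\<^sub>R u)) has_derivative (\<lambda>h. (\<mu> *\<^sub>R h) \<bullet> f' (w + \<mu> *\<^sub>R u))) (at u)" .
        show ?thesis
          unfolding gderiv_def using mu_pos
          by (auto intro!: derivative_eq_intros 1)
      qed
      show "\<bar>(f (w + \<mu> *\<^sub>R u) - f w) / \<mu>\<bar> \<le> (K + K / \<mu>) * (1 + norm u) ^ 2" for u
      proof -
        have "\<bar>(f (w + \<mu> *\<^sub>R u) - f w) / \<mu>\<bar> \<le> K / \<mu> * (1 + norm u) ^ 2"
          using K(2)[of u] mu_pos by (simp add: field_simps)
        also have "\<dots> \<le> (K + K / \<mu>) * (1 + norm u) ^ 2" using K(1) by (intro mult_right_mono) auto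
        finally show ?thesis .
      qed
      show "norm (f' (w + \<mu> *\<^sub>R u)) \<le> (K + K / \<mu>) * (1 + norm u) ^ 2" for u
        by (rule order_trans[OF K(3)]) (use K(1) mu_pos in \<open>auto intro!: mult_right_mono\<close>)
    qed simp
    also have "\<dots> = expectation (\<lambda>u. G0 u \<bullet> b)"
      by (simp add: G0_def)
    also have "\<dots> = (\<integral>u. G0 u \<partial>P) \<bullet> b" using int0 by simp
    finally show ?thesis by (simp add: integrable_f')
  qed
  have eq: "(\<integral>u. G0 u \<partial>P) = (\<integral>u. f' (w + \<mu> *\<^sub>R u) \<partial>P)"
    by (rule euclidean_eqI) (rule inner_eq)
  have "(\<integral>u. G w u \<partial>P) = (\<integral>u. J (G0 u) \<partial>P)"
    by (simp only: G_J)
  also have "\<dots> = J (\<integral>u. G0 u \<partial>P)"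
    by (rule integral_bounded_linear[OF bounded_linear_J int0])
  finally show ?thesis unfolding F\<mu>_def eq .
qed

end

subsection \<open>Noise of an independent batch\<close>

text \<open>Joint independence is restricted to two disjoint singleton index sets.\<close>

lemma (in prob_space) indep_vars_pair:
  assumes "indep_vars (\<lambda>_. N) X I" "i \<in> I" "j \<in> I" "i \<noteq> j"
    and [measurable]: "g \<in> measurable N S" "h \<in> measurable N T"
  shows "indep_var S (\<lambda>\<omega>. g (X i \<omega>)) T (\<lambda>\<omega>. h (X j \<omega>))"
proof -
  have "indep_var S ((\<lambda>v. g (v i)) \<circ> (\<lambda>\<omega>. restrict (\<lambda>i. X i \<omega>) {i}))
      T ((\<lambda>v. h (v j)) \<circ> (\<lambda>\<omega>. restrict (\<lambda>i. X i \<omega>) {j}))"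
    using assms(2-4) by (intro indep_var_compose[OF indep_var_restrict[OF assms(1)]]) auto
  then show ?thesis by (simp add: comp_def)
qed

context pos_def_op_bounds
begin

lemma measurable_wnorm_dual [measurable]: "wnorm_dual B \<in> borel_measurable borel"
  by (rule dual.measurable_wnorm)

text \<open>Independence factors expectations of scalar products, so the inner product is expanded
  in coordinates; each summand contains a mean of \<open>inv B (Y \<omega>)\<close>, which is
  zero.\<close>

lemma expectation_indep_inner:
  assumes M: "prob_space M" and ind: "prob_space.indep_var M borel X borel Y"
    and int: "integrable M X" "integrable M Y" and mean: "(\<integral>\<omega>. Y \<omega> \<partial>M) = 0"
  shows "integrable M (\<lambda>\<omega>. X \<omega> \<bullet> inv B (Y \<omega>))" "(\<integral>\<omega>. X \<omega> \<bullet> inv B (Y \<omega>) \<partial>M) = 0"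
proof -
  interpret prob_space M by (rule M)
  have bl: "bounded_linear (inv B)"
    using dual.lin by (simp add: linear_conv_bounded_linear)
  have int': "integrable M (\<lambda>\<omega>. inv B (Y \<omega>))"
    by (rule integrable_bounded_linear[OF bl int(2)])
  have mean': "(\<integral>\<omega>. inv B (Y \<omega>) \<partial>M) = 0"
    using integral_bounded_linear[OF bl int(2)] mean by (simp add: dual.lin_simps)
  have ind_b: "indep_var borel (\<lambda>\<omega>. X \<omega> \<bullet> b) borel (\<lambda>\<omega>. inv B (Y \<omega>) \<bullet> b)" for b
    using indep_var_compose[OF ind, of "\<lambda>x. x \<bullet> b" borel "\<lambda>y. inv B y \<bullet> b" borel] dual.measurable_B
    by (simp add: comp_def)
  have eq: "(\<lambda>\<omega>. X \<omega> \<bullet> inv B (Y \<omega>)) = (\<lambda>\<omega>. \<Sum>b\<in>Basis. (X \<omega> \<bullet> b) * (inv B (Y \<omega>) \<bullet> b))"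
    by (rule ext) (rule euclidean_inner)
  show "integrable M (\<lambda>\<omega>. X \<omega> \<bullet> inv B (Y \<omega>))"
    unfolding eq using int(1) int'
    by (intro Bochner_Integration.integrable_sum indep_var_integrable ind_b) auto
  have "(\<integral>\<omega>. X \<omega> \<bullet> inv B (Y \<omega>) \<partial>M) = (\<Sum>b\<in>Basis. (\<integral>\<omega>. (X \<omega> \<bullet> b) * (inv B (Y \<omega>) \<bullet> b) \<partial>M))"
    unfolding eq using int(1) int'
    by (intro Bochner_Integration.integral_sum indep_var_integrable ind_b) auto
  also have "\<dots> = (\<Sum>b\<in>Basis. (\<integral>\<omega>. X \<omega> \<bullet> b \<partial>M) * (\<integral>\<omega>. inv B (Y \<omega>) \<bullet> b \<partial>M))"
    using int(1) int' by (intro sum.cong refl indep_var_lebesgue_integral ind_b) auto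
  also have "\<dots> = 0" using int' mean' by simp
  finally show "(\<integral>\<omega>. X \<omega> \<bullet> inv B (Y \<omega>) \<partial>M) = 0" .
qed

text \<open>Bienayme's identity in the dual norm: the off-diagonal terms of the expanded square have
  expectation zero.\<close>

lemma variance_indep_sum:
  assumes M: "prob_space M" and ind: "prob_space.indep_vars M (\<lambda>_. borel) Y I" and fin: "finite I"
    and int: "\<And>i. i \<in> I \<Longrightarrow> integrable M (Y i)" and mean: "\<And>i. i \<in> I \<Longrightarrow> (\<integral>\<omega>. Y i \<omega> \<partial>M) = 0"
    and int2: "\<And>i. i \<in> I \<Longrightarrow> integrable M (\<lambda>\<omega>. (wnorm_dual B (Y i \<omega>))\<^sup>2)"
  shows "integrable M (\<lambda>\<omega>. (wnorm_dual B (\<Sum>i\<in>I. Y i \<omega>))\<^sup>2)"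
    "(\<integral>\<omega>. (wnorm_dual B (\<Sum>i\<in>I. Y i \<omega>))\<^sup>2 \<partial>M) = (\<Sum>i\<in>I. \<integral>\<omega>. (wnorm_dual B (Y i \<omega>))\<^sup>2 \<partial>M)"
proof -
  interpret prob_space M by (rule M)
  have "(wnorm_dual B (\<Sum>i\<in>I. Y i \<omega>))\<^sup>2 = (\<Sum>i\<in>I. \<Sum>j\<in>I. Y i \<omega> \<bullet> inv B (Y j \<omega>))" for \<omega>
    unfolding dual.wnorm_sq linear_sum[OF dual.lin] inner_sum_left inner_sum_right by (rule sum.swap)
  moreover have cross: "integrable M (\<lambda>\<omega>. Y i \<omega> \<bullet> inv B (Y j \<omega>)) \<and>
      (\<integral>\<omega>. Y i \<omega> \<bullet> inv B (Y j \<omega>) \<partial>M) = (if j = i then (\<integral>\<omega>. (wnorm_dual B (Y i \<omega>))\<^sup>2 \<partial>M) else 0)"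
    if ij: "i \<in> I" "j \<in> I" for i j
  proof (cases "j = i")
    case True
    then show ?thesis using int2[OF ij(1)] by (simp add: dual.wnorm_sq)
  next
    case False
    have "indep_var borel (Y i) borel (Y j)"
      using indep_vars_pair[OF ind ij, of "\<lambda>x. x" borel "\<lambda>x. x" borel] False by simp
    from expectation_indep_inner[OF M this int[OF ij(1)] int[OF ij(2)] mean[OF ij(2)]] False
    show ?thesis by simp
  qed
  ultimately show "integrable M (\<lambda>\<omega>. (wnorm_dual B (\<Sum>i\<in>I. Y i \<omega>))\<^sup>2)"
    "(\<integral>\<omega>. (wnorm_dual B (\<Sum>i\<in>I. Y i \<omega>))\<^sup>2 \<partial>M) = (\<Sum>i\<in>I. \<integral>\<omega>. (wnorm_dual B (Y i \<omega>))\<^sup>2 \<partial>M)"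
    using fin by (simp_all add: Bochner_Integration.integral_sum)
qed

end

lemma (in prob_space) nn_integral_indep_le:
  assumes ind: "indep_var S X T Y" and [measurable]: "\<phi> \<in> borel_measurable (S \<Otimes>\<^sub>M T)"
    and le: "\<And>x. x \<in> space S \<Longrightarrow> (\<integral>\<^sup>+\<omega>. \<phi> (x, Y \<omega>) \<partial>M) \<le> C"
  shows "(\<integral>\<^sup>+\<omega>. \<phi> (X \<omega>, Y \<omega>) \<partial>M) \<le> C"
proof -
  have [measurable]: "X \<in> measurable M S" "Y \<in> measurable M T"
    using indep_var_rv1[OF ind] indep_var_rv2[OF ind] by auto
  have eq: "distr M S X \<Otimes>\<^sub>M distr M T Y = distr M (S \<Otimes>\<^sub>M T) (\<lambda>\<omega>. (X \<omega>, Y \<omega>))"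
    using ind by (simp add: indep_var_distribution_eq)
  interpret X: prob_space "distr M S X" by (rule prob_space_distr) simp
  interpret Y: prob_space "distr M T Y" by (rule prob_space_distr) simp
  have "(\<integral>\<^sup>+\<omega>. \<phi> (X \<omega>, Y \<omega>) \<partial>M) = (\<integral>\<^sup>+p. \<phi> p \<partial>distr M (S \<Otimes>\<^sub>M T) (\<lambda>\<omega>. (X \<omega>, Y \<omega>)))"
    by (simp add: nn_integral_distr)
  also have "\<dots> = (\<integral>\<^sup>+x. \<integral>\<^sup>+y. \<phi> (x, y) \<partial>distr M T Y \<partial>distr M S X)"
    unfolding eq[symmetric] by (subst Y.nn_integral_fst[symmetric]) auto
  also have "\<dots> \<le> (\<integral>\<^sup>+x. C \<partial>distr M S X)"
    by (intro nn_integral_mono) (simp add: nn_integral_distr le)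
  also have "\<dots> = C" using X.emeasure_space_1 by simp
  finally show ?thesis .
qed

context smoothing
begin

lemma continuous_F\<mu>: "continuous_on UNIV F\<mu>"
proof (rule lipschitz_on_continuous_on)
  have "norm (F\<mu> v - F\<mu> w) \<le> L * lmax * norm (v - w)" for v w
  proof -
    have "norm (F\<mu> v - F\<mu> w) \<le> sqrt lmax * wnorm_dual B (F\<mu> v - F\<mu> w)" by (rule norm_le_wnorm_dual)
    also have "\<dots> \<le> sqrt lmax * (L * (sqrt lmax * norm (v - w)))"
      using lmax_pos L_nonneg
      by (intro mult_left_mono order_trans[OF F\<mu>_Lipschitz] wnorm_le_norm) auto
    also have "\<dots> = L * lmax * norm (v - w)" using lmax_pos by (simp add: mult.left_commute flip: mult.assoc)
    finally show ?thesis .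
  qed
  then show "(L * lmax)-lipschitz_on UNIV F\<mu>"
    using L_nonneg lmax_pos by (auto simp: lipschitz_on_def dist_norm)
qed

lemma measurable_F\<mu> [measurable]: "F\<mu> \<in> borel_measurable borel"
  by (rule borel_measurable_continuous_onI[OF continuous_F\<mu>])

text \<open>Unbiasedness centres the summands, independence adds their variances, and averaging
  divides by the batch size. The extended integral is the form that
  \<open>nn_integral_indep_le\<close> takes as input.\<close>

lemma batch_variance:
  assumes M: "prob_space M" and ind: "prob_space.indep_vars M (\<lambda>_. borel) X I"
    and I: "finite I" "I \<noteq> {}" and law: "\<And>i. i \<in> I \<Longrightarrow> distr M borel (X i) = P"
    and var: "(\<integral>u. (wnorm_dual B (G w u - F\<mu> w))\<^sup>2 \<partial>P) \<le> \<sigma>\<^sup>2"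
  shows "(\<integral>\<^sup>+\<omega>. ennreal ((wnorm_dual B ((1 / real (card I)) *\<^sub>R (\<Sum>i\<in>I. G w (X i \<omega>)) - F\<mu> w))\<^sup>2) \<partial>M)
      \<le> ennreal (\<sigma>\<^sup>2 / real (card I))"
proof -
  interpret M: prob_space M by (rule M)
  define Y where "Y i \<omega> = G w (X i \<omega>) - F\<mu> w" for i \<omega>
  have X: "X i \<in> borel_measurable M" if "i \<in> I" for i
    using ind that by (auto simp: M.indep_vars_def)
  have ind_Y: "M.indep_vars (\<lambda>_. borel) Y I"
    unfolding Y_def by (rule M.indep_vars_compose2[OF ind]) measurable
  have int_P: "integrable P (\<lambda>u. G w u - F\<mu> w)"
    by (simp add: integrable_G)
  have int: "integrable M (Y i)" if "i \<in> I" for i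
    using int_P unfolding law[OF that, symmetric] Y_def[abs_def]
    by (subst (asm) integrable_distr_eq) (auto simp: X that)
  have mean: "(\<integral>\<omega>. Y i \<omega> \<partial>M) = 0" if "i \<in> I" for i
  proof -
    have "(\<integral>\<omega>. Y i \<omega> \<partial>M) = (\<integral>u. G w u - F\<mu> w \<partial>P)"
      unfolding law[OF that, symmetric] Y_def by (subst integral_distr) (auto simp: X that)
    also have "\<dots> = 0" using prob_space by (simp add: integrable_G oracle_unbiased)
    finally show ?thesis .
  qed
  have int2: "integrable M (\<lambda>\<omega>. (wnorm_dual B (Y i \<omega>))\<^sup>2)" if "i \<in> I" for i
    using integrable_wnorm_dual_sq[of w "F\<mu> w"] unfolding law[OF that, symmetric] Y_def
    by (subst (asm) integrable_distr_eq) (auto simp: X that)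
  have var_Y: "(\<integral>\<omega>. (wnorm_dual B (Y i \<omega>))\<^sup>2 \<partial>M) \<le> \<sigma>\<^sup>2" if "i \<in> I" for i
  proof -
    have "(\<integral>\<omega>. (wnorm_dual B (Y i \<omega>))\<^sup>2 \<partial>M) = (\<integral>u. (wnorm_dual B (G w u - F\<mu> w))\<^sup>2 \<partial>P)"
      unfolding law[OF that, symmetric] Y_def by (subst integral_distr) (auto simp: X that)
    then show ?thesis using var by simp
  qed
  have sum: "integrable M (\<lambda>\<omega>. (wnorm_dual B (\<Sum>i\<in>I. Y i \<omega>))\<^sup>2)"
    "(\<integral>\<omega>. (wnorm_dual B (\<Sum>i\<in>I. Y i \<omega>))\<^sup>2 \<partial>M) = (\<Sum>i\<in>I. \<integral>\<omega>. (wnorm_dual B (Y i \<omega>))\<^sup>2 \<partial>M)"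
    by (auto intro!: variance_indep_sum[OF M ind_Y I(1)] int mean int2)
  have n: "0 < real (card I)" using I by (simp add: card_gt_0_iff)
  \<comment> \<open>Centring the average is averaging the centred terms, because the weights of a
    nonempty batch sum to one.\<close>
  have eq: "(wnorm_dual B ((1 / real (card I)) *\<^sub>R (\<Sum>i\<in>I. G w (X i \<omega>)) - F\<mu> w))\<^sup>2
      = (wnorm_dual B (\<Sum>i\<in>I. Y i \<omega>))\<^sup>2 / (real (card I))\<^sup>2" for \<omega>
  proof -
    have "(1 / real (card I)) *\<^sub>R (\<Sum>i\<in>I. G w (X i \<omega>)) - F\<mu> w = (1 / real (card I)) *\<^sub>R (\<Sum>i\<in>I. Y i \<omega>)"
      using n by (simp add: Y_def sum_subtractf scaleR_diff_right sum_constant_scaleR)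
    then show ?thesis by (simp add: dual.wnorm_scale power_divide)
  qed
  have "(\<integral>\<omega>. (wnorm_dual B (\<Sum>i\<in>I. Y i \<omega>))\<^sup>2 \<partial>M) \<le> real (card I) * \<sigma>\<^sup>2"
    unfolding sum(2) using sum_mono[of I "\<lambda>i. \<integral>\<omega>. (wnorm_dual B (Y i \<omega>))\<^sup>2 \<partial>M" "\<lambda>_. \<sigma>\<^sup>2"] var_Y by simp
  then have "(\<integral>\<omega>. (wnorm_dual B (\<Sum>i\<in>I. Y i \<omega>))\<^sup>2 / (real (card I))\<^sup>2 \<partial>M) \<le> \<sigma>\<^sup>2 / real (card I)"
    using n by (simp add: field_simps power2_eq_square)
  then show ?thesis
    unfolding eq by (subst nn_integral_eq_integral) (auto simp: sum(1) intro!: ennreal_leI)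
qed

text \<open>The point \<open>y\<close> depends only on samples that are independent of the batch, so that
  the bound for a fixed point can be applied conditionally on \<open>y\<close>.\<close>

lemma adaptive_batch_noise:
  fixes X :: "'i \<Rightarrow> 'w \<Rightarrow> 'a"
  assumes M: "prob_space M" and ind: "prob_space.indep_vars M (\<lambda>_. borel) X I"
    and AI: "A \<inter> Bt = {}" "A \<subseteq> I" "Bt \<subseteq> I" and Bt: "finite Bt" "Bt \<noteq> {}"
    and law: "\<And>i. i \<in> Bt \<Longrightarrow> distr M borel (X i) = P"
    and g: "g \<in> borel_measurable (PiM A (\<lambda>_. borel))"
    and y: "\<And>\<omega>. \<omega> \<in> space M \<Longrightarrow> y \<omega> = g (restrict (\<lambda>i. X i \<omega>) A)"
    and \<sigma>: "0 \<le> \<sigma>" and var: "\<And>w. (\<integral>u. (wnorm_dual B (G w u - F\<mu> w))\<^sup>2 \<partial>P) \<le> \<sigma>\<^sup>2"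
  defines "n \<equiv> (\<lambda>\<omega>. wnorm_dual B ((1 / real (card Bt)) *\<^sub>R (\<Sum>i\<in>Bt. G (y \<omega>) (X i \<omega>)) - F\<mu> (y \<omega>)))"
  shows "integrable M n" "integrable M (\<lambda>\<omega>. (n \<omega>)\<^sup>2)"
    "(\<integral>\<omega>. (n \<omega>)\<^sup>2 \<partial>M) \<le> \<sigma>\<^sup>2 / real (card Bt)" "(\<integral>\<omega>. n \<omega> \<partial>M) \<le> \<sigma> / sqrt (real (card Bt))"
proof -
  interpret M: prob_space M by (rule M)
  have X: "X i \<in> borel_measurable M" if "i \<in> I" for i
    using ind that by (auto simp: M.indep_vars_def)
  \<comment> \<open>The squared noise as a function of point and batch together; its joint
    measurability is what allows the point to be frozen.\<close>
  define \<phi> where "\<phi> = (\<lambda>(w, v). (wnorm_dual B ((1 / real (card Bt)) *\<^sub>R (\<Sum>i\<in>Bt. G w (v i)) - F\<mu> w))\<^sup>2)"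
  have \<phi>[measurable]: "\<phi> \<in> borel_measurable (borel \<Otimes>\<^sub>M PiM Bt (\<lambda>_. borel))"
  proof -
    have [measurable]: "(\<lambda>p. G (fst p) (snd p i)) \<in> borel_measurable (borel \<Otimes>\<^sub>M PiM Bt (\<lambda>_. borel))"
      if "i \<in> Bt" for i
    proof -
      have "(\<lambda>p. (fst p, snd p i)) \<in> measurable (borel \<Otimes>\<^sub>M PiM Bt (\<lambda>_. borel)) ((borel::'a measure) \<Otimes>\<^sub>M (borel::'a measure))"
        using that by measurable
      from measurable_compose[OF this measurable_G] show ?thesis by simp
    qed
    show ?thesis unfolding \<phi>_def case_prod_unfold by measurable
  qed
  have y_meas: "y \<in> borel_measurable M"
  proof -
    have "(\<lambda>\<omega>. restrict (\<lambda>i. X i \<omega>) A) \<in> measurable M (PiM A (\<lambda>_. borel))"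
      using X AI by (intro measurable_restrict) auto
    from measurable_compose[OF this g] show ?thesis
      by (subst measurable_cong[OF y]) auto
  qed
  have restrict_meas: "(\<lambda>\<omega>. restrict (\<lambda>i. X i \<omega>) Bt) \<in> measurable M (PiM Bt (\<lambda>_. borel))"
    using X AI by (intro measurable_restrict) auto
  have n_sq: "(n \<omega>)\<^sup>2 = \<phi> (y \<omega>, restrict (\<lambda>i. X i \<omega>) Bt)" for \<omega>
    by (simp add: n_def \<phi>_def)
  have n_nonneg: "0 \<le> n \<omega>" for \<omega> by (simp add: n_def dual.wnorm_nonneg)
  have sq_meas: "(\<lambda>\<omega>. (n \<omega>)\<^sup>2) \<in> borel_measurable M"
    unfolding n_sq using y_meas restrict_meas by measurable
  have n_meas: "n \<in> borel_measurable M"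
  proof -
    have "(\<lambda>\<omega>. sqrt ((n \<omega>)\<^sup>2)) \<in> borel_measurable M" using sq_meas by measurable
    then show ?thesis by (simp add: n_nonneg)
  qed
  have "(\<integral>\<^sup>+\<omega>. ennreal ((n \<omega>)\<^sup>2) \<partial>M)
      = (\<integral>\<^sup>+\<omega>. ennreal (\<phi> (g (restrict (\<lambda>i. X i \<omega>) A), restrict (\<lambda>i. X i \<omega>) Bt)) \<partial>M)"
    by (intro nn_integral_cong) (simp add: n_sq y)
  also have "\<dots> \<le> ennreal (\<sigma>\<^sup>2 / real (card Bt))"
  proof (rule M.nn_integral_indep_le[OF M.indep_var_restrict[OF ind AI],
        of "\<lambda>(a, v). ennreal (\<phi> (g a, v))", simplified])
    show "(\<lambda>(a, v). ennreal (\<phi> (g a, v)))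
        \<in> borel_measurable (PiM A (\<lambda>_. borel) \<Otimes>\<^sub>M PiM Bt (\<lambda>_. borel))"
      using g by measurable
    show "(\<integral>\<^sup>+\<omega>. ennreal (\<phi> (g a, restrict (\<lambda>i. X i \<omega>) Bt)) \<partial>M) \<le> ennreal (\<sigma>\<^sup>2 / real (card Bt))" for a
      using batch_variance[OF M M.indep_vars_subset[OF ind AI(3)] Bt law var, of "g a"]
      by (simp add: \<phi>_def)
  qed
  finally have le: "(\<integral>\<^sup>+\<omega>. ennreal ((n \<omega>)\<^sup>2) \<partial>M) \<le> ennreal (\<sigma>\<^sup>2 / real (card Bt))" .
  show int2: "integrable M (\<lambda>\<omega>. (n \<omega>)\<^sup>2)"
    using le sq_meas by (intro integrableI_nonneg) (auto simp: le_less_trans[OF _ ennreal_less_top])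
  show sq: "(\<integral>\<omega>. (n \<omega>)\<^sup>2 \<partial>M) \<le> \<sigma>\<^sup>2 / real (card Bt)"
    using le int2 by (simp add: nn_integral_eq_integral)
  show int: "integrable M n"
    by (rule M.square_integrable_imp_integrable[OF n_meas int2])
  \<comment> \<open>Nonnegative variance turns the second-moment bound into the first-moment bound,
    with its square root in the batch size.\<close>
  have "0 \<le> M.expectation (\<lambda>\<omega>. (n \<omega> - M.expectation n)\<^sup>2)" by simp
  also have "\<dots> = M.expectation (\<lambda>\<omega>. (n \<omega>)\<^sup>2) - (M.expectation n)\<^sup>2"
    by (rule M.variance_eq[OF int int2])
  finally have "(M.expectation n)\<^sup>2 \<le> \<sigma>\<^sup>2 / real (card Bt)" using sq by simp
  then have "M.expectation n \<le> sqrt (\<sigma>\<^sup>2 / real (card Bt))" by (rule real_le_rsqrt)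
  then show "(\<integral>\<omega>. n \<omega> \<partial>M) \<le> \<sigma> / sqrt (real (card Bt))"
    using \<sigma> by (simp add: real_sqrt_divide)
qed

end

subsection \<open>One extragradient step\<close>

text \<open>The weights are deliberately uneven: \<open>c\<close> takes the term in |z - zh|, which
  has to be absorbed and so gets the small factor 2, while \<open>a\<close> and \<open>b\<close>
  take noise and bias.\<close>

lemma sum3_sq_le: "(a + b + c)\<^sup>2 \<le> 4 * a\<^sup>2 + 4 * b\<^sup>2 + 2 * c\<^sup>2" for a b c :: real
proof -
  have "0 \<le> 2 * (a - b)\<^sup>2 + (a + b - c)\<^sup>2" by simp
  then show ?thesis by (simp add: power2_eq_square algebra_simps)
qed

context pos_def_op_bounds
begin

text \<open>\<open>n1\<close> and \<open>n2\<close> are the errors of the stochastic gradients, \<open>b\<close> bounds the smoothing bias.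
  The weak Minty inequality is used at the noiseless second step \<open>zt\<close>.\<close>

lemma extragradient_step:
  fixes F Fs :: "'a \<Rightarrow> 'a" and z g gh zs :: 'a and \<rho> h L b \<kappa> :: real
  assumes Z: "compact Z" "Z \<noteq> {}" "convex Z"
    and F_lip: "\<And>v w. wnorm_dual B (F v - F w) \<le> L * wnorm B (v - w)"
    and Fs_lip: "\<And>v w. wnorm_dual B (Fs v - Fs w) \<le> L * wnorm B (v - w)"
    and bias: "\<And>w. wnorm_dual B (Fs w - F w) \<le> b"
    and L: "0 < L" and \<kappa>: "\<kappa> = lmax / lmin" and h: "0 < h" "h \<le> 1 / (2 * L * \<kappa> * lmax)"
    and \<rho>: "0 \<le> \<rho>" and MVI: "prox_weak_MVI B Z F \<rho> zs" and zs: "zs \<in> Z" and z: "z \<in> Z"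
  defines "zh \<equiv> Proj B Z (z - h *\<^sub>R gh)" and "zp \<equiv> Proj B Z (z - h *\<^sub>R g)"
  defines "n1 \<equiv> wnorm_dual B (gh - Fs z)" and "n2 \<equiv> wnorm_dual B (g - Fs zh)"
  shows "(h\<^sup>2 / 2 - 3 * \<rho> / (L * lmin * lmax * \<kappa>)) * (norm ((1 / h) *\<^sub>R (z - zh)))\<^sup>2
    \<le> (norm (z - zs))\<^sup>2 - (norm (zp - zs))\<^sup>2 + wdiameter B Z / (L * lmax) * (n2 + b)
      + 2 * \<rho> * \<kappa> / (L * lmax) * (n1\<^sup>2 + b\<^sup>2) + 1 / (L\<^sup>2 * \<kappa> * lmax) * (n1\<^sup>2 + n2\<^sup>2)"
proof -
  define zt where "zt = Proj B Z (z - h *\<^sub>R F zh)"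
  define S where "S = norm (z - zh)"
  \<comment> \<open>The step size in units in which its upper bound reads
    \<open>q \<le> 1 / 2\<close>; below, powers of \<open>h\<close> are traded for powers of
    \<open>q\<close>.\<close>
  define q where "q = h * L * \<kappa> * lmax"
  have lm: "0 < lmin" "0 < lmax" by (rule lmin_pos lmax_pos)+
  have \<kappa>1: "1 \<le> \<kappa>" using lm lmin_le_lmax by (simp add: \<kappa>)
  have lk: "lmax = \<kappa> * lmin" using lm by (simp add: \<kappa>)
  have q: "0 < q" "q \<le> 1 / 2" using h L lm \<kappa>1 by (auto simp: q_def field_simps)
  have S0: "0 \<le> S" by (simp add: S_def)
  have n: "0 \<le> n1" "0 \<le> n2" by (simp_all add: n1_def n2_def dual.wnorm_nonneg)
  have b0: "0 \<le> b" using order_trans[OF dual.wnorm_nonneg bias] .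
  have zh: "zh \<in> Z" unfolding zh_def by (rule Proj_minimal(1)[OF Z(1,2)])
  have step: "wnorm B (Proj B Z (z - h *\<^sub>R v) - Proj B Z (z - h *\<^sub>R w)) \<le> h * lmax * wnorm_dual B (v - w)" for v w
  proof -
    have "wnorm B (Proj B Z (z - h *\<^sub>R v) - Proj B Z (z - h *\<^sub>R w)) \<le> wnorm B ((z - h *\<^sub>R v) - (z - h *\<^sub>R w))"
      by (rule Proj_nonexpansive[OF Z])
    also have "(z - h *\<^sub>R v) - (z - h *\<^sub>R w) = h *\<^sub>R (w - v)" by (simp add: algebra_simps)
    also have "wnorm B \<dots> = h * wnorm B (v - w)" using h by (simp add: wnorm_scale wnorm_minus_commute)
    also have "\<dots> \<le> h * (lmax * wnorm_dual B (v - w))"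
      using h by (intro mult_left_mono wnorm_le_wnorm_dual) auto
    finally show ?thesis by (simp add: mult.assoc)
  qed
  have dstep: "wnorm_dual B (Proj B Z (z - h *\<^sub>R v) - Proj B Z (z - h *\<^sub>R w)) \<le> h * \<kappa> * wnorm_dual B (v - w)" for v w
  proof -
    have "lmin * wnorm_dual B (Proj B Z (z - h *\<^sub>R v) - Proj B Z (z - h *\<^sub>R w)) \<le> h * lmax * wnorm_dual B (v - w)"
      by (rule order_trans[OF wnorm_dual_le_wnorm step])
    then show ?thesis using lm by (simp add: \<kappa> field_simps)
  qed
  have LS: "L * wnorm B (z - zh) \<le> L * sqrt lmax * S" "L * wnorm B (zh - z) \<le> L * sqrt lmax * S"
    using wnorm_le_norm[of "z - zh"] wnorm_minus_commute[of zh z] L by (auto simp: S_def mult.assoc)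
  \<comment> \<open>Both points are projected steps from the same \<open>z\<close>, so their
    distance is governed by \<open>g - gh\<close>. This splits into two noise terms and a Lipschitz
    part between \<open>zh\<close> and \<open>z\<close>, bounded by a multiple of
    \<open>S\<close>.\<close>
  have gap: "(norm (zp - zh))\<^sup>2 \<le> S\<^sup>2 / 2 + 1 / (L\<^sup>2 * \<kappa> * lmax) * (n1\<^sup>2 + n2\<^sup>2)"
  proof -
    have "wnorm_dual B (g - gh) \<le> n2 + n1 + L * sqrt lmax * S"
    proof -
      have "wnorm_dual B (g - gh) = wnorm_dual B ((g - Fs zh) + ((Fs z - gh) + (Fs zh - Fs z)))" by simp
      also have "\<dots> \<le> wnorm_dual B (g - Fs zh) + (wnorm_dual B (Fs z - gh) + wnorm_dual B (Fs zh - Fs z))"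
        by (intro order_trans[OF dual.wnorm_triangle] add_left_mono dual.wnorm_triangle)
      also have "wnorm_dual B (Fs z - gh) = n1" by (simp add: n1_def dual.wnorm_minus_commute)
      finally show ?thesis using Fs_lip[of zh z] LS(2) by (simp add: n2_def)
    qed
    then have "(wnorm_dual B (g - gh))\<^sup>2 \<le> (n2 + n1 + L * sqrt lmax * S)\<^sup>2"
      by (intro power_mono dual.wnorm_nonneg)
    also have "\<dots> \<le> 4 * n2\<^sup>2 + 4 * n1\<^sup>2 + 2 * (L * sqrt lmax * S)\<^sup>2" by (rule sum3_sq_le)
    also have "(L * sqrt lmax * S)\<^sup>2 = L\<^sup>2 * lmax * S\<^sup>2" using lm by (simp add: power_mult_distrib)
    finally have d: "(wnorm_dual B (g - gh))\<^sup>2 \<le> 4 * (n1\<^sup>2 + n2\<^sup>2) + 2 * L\<^sup>2 * lmax * S\<^sup>2" by simp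
    have "sqrt lmin * norm (zp - zh) \<le> h * lmax * wnorm_dual B (g - gh)"
      unfolding zp_def zh_def by (rule order_trans[OF norm_le_wnorm step])
    then have "(sqrt lmin * norm (zp - zh))\<^sup>2 \<le> (h * lmax * wnorm_dual B (g - gh))\<^sup>2"
      using lm by (intro power_mono) auto
    then have "lmin * (norm (zp - zh))\<^sup>2 \<le> (h * lmax)\<^sup>2 * (wnorm_dual B (g - gh))\<^sup>2"
      using lm by (simp add: power_mult_distrib)
    also have "\<dots> \<le> (h * lmax)\<^sup>2 * (4 * (n1\<^sup>2 + n2\<^sup>2) + 2 * L\<^sup>2 * lmax * S\<^sup>2)"
      using d by (intro mult_left_mono) auto
    finally have "(norm (zp - zh))\<^sup>2 \<le> (h * lmax)\<^sup>2 * (4 * (n1\<^sup>2 + n2\<^sup>2) + 2 * L\<^sup>2 * lmax * S\<^sup>2) / lmin"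
      using lm by (simp add: field_simps)
    also have "\<dots> = q\<^sup>2 * (4 * (1 / (L\<^sup>2 * \<kappa> * lmax) * (n1\<^sup>2 + n2\<^sup>2)) + 2 * (S\<^sup>2 / \<kappa>))"
      using lm L \<kappa>1 by (simp add: q_def lk power2_eq_square field_simps)
    \<comment> \<open>Here \<open>q \<le> 1 / 2\<close> reduces the weight of
      \<open>S\<^sup>2\<close> from 2 to \<open>1 / 2\<close>, so that half of the
      \<open>S\<^sup>2\<close> subtracted in \<open>id\<close> is left over.\<close>
    also have "\<dots> \<le> (1 / 2)\<^sup>2 * (4 * (1 / (L\<^sup>2 * \<kappa> * lmax) * (n1\<^sup>2 + n2\<^sup>2)) + 2 * S\<^sup>2)"
    proof (intro mult_mono power_mono add_left_mono mult_left_mono)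
      show "S\<^sup>2 / \<kappa> \<le> S\<^sup>2" using \<kappa>1 divide_left_mono[of 1 \<kappa> "S\<^sup>2"] by simp
    qed (use q lm \<kappa>1 in auto)
    also have "\<dots> = S\<^sup>2 / 2 + 1 / (L\<^sup>2 * \<kappa> * lmax) * (n1\<^sup>2 + n2\<^sup>2)"
    proof -
      have "(1 / 2)\<^sup>2 * (4 * x + 2 * y) = y / 2 + x" for x y :: real
        by (simp add: power2_eq_square)
      then show ?thesis .
    qed
    finally show ?thesis .
  qed
  \<comment> \<open>The Minty inequality at \<open>z\<close> and \<open>zh\<close> with
    \<open>a = h\<close>, where the proximal map is \<open>(1 / h) *\<^sub>R (z - zt)\<close>. Its
    quadratic term is estimated via \<open>zh\<close>: passing from \<open>zh\<close> to
    \<open>zt\<close> only changes the direction from \<open>gh\<close> to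
    \<open>F zh\<close>.\<close>
  have weak: "- 2 * ((z - zt) \<bullet> (zh - zs)) \<le> 3 * \<rho> / (L * lmin * lmax * \<kappa> * h\<^sup>2) * S\<^sup>2
      + 2 * \<rho> * \<kappa> / (L * lmax) * (n1\<^sup>2 + b\<^sup>2)"
  proof -
    have "0 \<le> ((1 / h) *\<^sub>R (z - zt)) \<bullet> (zh - zs) + \<rho> / 2 * (wnorm_dual B ((1 / h) *\<^sub>R (z - zt)))\<^sup>2"
      using MVI z zh h by (auto simp: prox_weak_MVI_def prox_map_def zt_def)
    also have "\<dots> = (2 * ((z - zt) \<bullet> (zh - zs)) + \<rho> / h * (wnorm_dual B (z - zt))\<^sup>2) / (2 * h)"
      unfolding dual.wnorm_scale inner_scaleR_left
      using h by (simp add: power_mult_distrib power2_eq_square field_simps)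
    finally have mvi: "- 2 * ((z - zt) \<bullet> (zh - zs)) \<le> \<rho> / h * (wnorm_dual B (z - zt))\<^sup>2"
      using h by (simp add: zero_le_divide_iff)
    have "wnorm_dual B (gh - F zh) \<le> n1 + b + L * sqrt lmax * S"
    proof -
      have "wnorm_dual B (gh - F zh) = wnorm_dual B ((gh - Fs z) + ((Fs z - F z) + (F z - F zh)))" by simp
      also have "\<dots> \<le> wnorm_dual B (gh - Fs z) + (wnorm_dual B (Fs z - F z) + wnorm_dual B (F z - F zh))"
        by (intro order_trans[OF dual.wnorm_triangle] add_left_mono dual.wnorm_triangle)
      finally show ?thesis using F_lip[of z zh] LS(1) bias[of z] by (simp add: n1_def)
    qed
    then have "wnorm_dual B (zh - zt) \<le> h * \<kappa> * (n1 + b + L * sqrt lmax * S)"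
      unfolding zh_def zt_def using h \<kappa>1
      by (intro order_trans[OF dstep] mult_left_mono) (auto simp: zh_def)
    moreover have "h * \<kappa> * (L * sqrt lmax * S) \<le> (1 / 2) * (S / sqrt lmin)"
    proof -
      have "h * \<kappa> * (L * sqrt lmax * S) = q * (S / sqrt lmax)"
        using lm by (simp add: q_def field_simps)
      also have "\<dots> \<le> (1 / 2) * (S / sqrt lmin)"
        using q lm lmin_le_lmax S0 by (intro mult_mono divide_left_mono) auto
      finally show ?thesis .
    qed
    moreover have "wnorm_dual B (z - zh) \<le> S / sqrt lmin"
      using wnorm_dual_le_norm[of "z - zh"] lm by (simp add: S_def field_simps)
    moreover have "wnorm_dual B (z - zt) \<le> wnorm_dual B (z - zh) + wnorm_dual B (zh - zt)"
      using dual.wnorm_triangle[of "z - zh" "zh - zt"] by simp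
    \<comment> \<open>The factor \<open>3 / 2\<close> consists of 1 for the leg from
      \<open>z\<close> to \<open>zh\<close> and \<open>1 / 2\<close> for the Lipschitz part of the
      leg from \<open>zh\<close> to \<open>zt\<close>.\<close>
    ultimately have "wnorm_dual B (z - zt) \<le> 3 / 2 * (S / sqrt lmin) + h * \<kappa> * (n1 + b)"
      by (simp add: distrib_left)
    then have "(wnorm_dual B (z - zt))\<^sup>2 \<le> (h * \<kappa> * n1 + h * \<kappa> * b + 3 / 2 * (S / sqrt lmin))\<^sup>2"
      by (intro power_mono dual.wnorm_nonneg) (simp add: algebra_simps)
    also have "\<dots> \<le> 4 * (h * \<kappa> * n1)\<^sup>2 + 4 * (h * \<kappa> * b)\<^sup>2 + 2 * (3 / 2 * (S / sqrt lmin))\<^sup>2"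
      by (rule sum3_sq_le)
    also have "\<dots> = 4 * (h * \<kappa>)\<^sup>2 * (n1\<^sup>2 + b\<^sup>2) + 9 / 2 * (S\<^sup>2 / lmin)"
      using lm by (simp add: power_mult_distrib power_divide field_simps)
    finally have "\<rho> / h * (wnorm_dual B (z - zt))\<^sup>2
        \<le> \<rho> / h * (4 * (h * \<kappa>)\<^sup>2 * (n1\<^sup>2 + b\<^sup>2) + 9 / 2 * (S\<^sup>2 / lmin))"
      using \<rho> h by (intro mult_left_mono) auto
    also have "\<dots> = q * (4 * (\<rho> * \<kappa> / (L * lmax) * (n1\<^sup>2 + b\<^sup>2)))
        + q * (9 / 2 * (\<rho> / (L * lmin * lmax * \<kappa> * h\<^sup>2) * S\<^sup>2))"
      using lm L \<kappa>1 h by (simp add: q_def power2_eq_square field_simps)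
    \<comment> \<open>The second occurrence of \<open>q\<close> is relaxed to \<open>2 / 3\<close>
      so that \<open>9 / 2\<close> becomes the constant 3 of the claim.\<close>
    also have "\<dots> \<le> (1 / 2) * (4 * (\<rho> * \<kappa> / (L * lmax) * (n1\<^sup>2 + b\<^sup>2)))
        + (2 / 3) * (9 / 2 * (\<rho> / (L * lmin * lmax * \<kappa> * h\<^sup>2) * S\<^sup>2))"
      using q \<rho> lm L \<kappa>1 by (intro add_mono mult_right_mono) auto
    also have "\<dots> = 3 * \<rho> / (L * lmin * lmax * \<kappa> * h\<^sup>2) * S\<^sup>2 + 2 * \<rho> * \<kappa> / (L * lmax) * (n1\<^sup>2 + b\<^sup>2)"
      using lm L \<kappa>1 h by (simp add: field_simps)
    finally show ?thesis using mvi by simp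
  qed
  \<comment> \<open>\<open>zp\<close> deviates from the noiseless step by the noise of
    \<open>g\<close> and the bias. The other factor \<open>zh - zs\<close> need not be small and is
    bounded by the diameter only.\<close>
  have cross: "- 2 * ((zt - zp) \<bullet> (zh - zs)) \<le> wdiameter B Z / (L * lmax) * (n2 + b)"
  proof -
    have "wnorm_dual B (F zh - g) \<le> n2 + b"
    proof -
      have "wnorm_dual B (F zh - g) = wnorm_dual B ((g - Fs zh) + (Fs zh - F zh))"
        by (simp add: dual.wnorm_minus_commute)
      also have "\<dots> \<le> n2 + b" using dual.wnorm_triangle[of "g - Fs zh" "Fs zh - F zh"] bias[of zh]
        by (simp add: n2_def)
      finally show ?thesis .
    qed
    then have 1: "wnorm_dual B (zt - zp) \<le> h * \<kappa> * (n2 + b)"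
      unfolding zp_def zt_def using h \<kappa>1 by (intro order_trans[OF dstep] mult_left_mono) auto
    have D: "wnorm B (zh - zs) \<le> wdiameter B Z" by (rule wnorm_le_wdiameter[OF Z(1) zh zs])
    have "- 2 * ((zt - zp) \<bullet> (zh - zs)) \<le> 2 * (wnorm_dual B (zt - zp) * wnorm B (zh - zs))"
      using inner_le_wnorm[of "zt - zp" "zh - zs"] by linarith
    also have "\<dots> \<le> 2 * (h * \<kappa> * (n2 + b) * wdiameter B Z)"
      using 1 D n b0 h \<kappa>1 wnorm_nonneg by (intro mult_left_mono mult_mono) auto
    also have "\<dots> = q * (2 * (wdiameter B Z / (L * lmax) * (n2 + b)))"
      using L lm by (simp add: q_def field_simps)
    also have "\<dots> \<le> (1 / 2) * (2 * (wdiameter B Z / (L * lmax) * (n2 + b)))"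
      using q L lm n b0 order_trans[OF wnorm_nonneg D] by (intro mult_right_mono) auto
    finally show ?thesis by simp
  qed
  \<comment> \<open>Pure polarisation, with \<open>z - zp\<close> split at \<open>zt\<close>; no
    property of the projections is involved.\<close>
  have id: "(norm (zp - zs))\<^sup>2 = (norm (z - zs))\<^sup>2 - S\<^sup>2 + (norm (zp - zh))\<^sup>2
      + (- 2 * ((z - zt) \<bullet> (zh - zs)) + - 2 * ((zt - zp) \<bullet> (zh - zs)))"
    unfolding S_def power2_norm_eq_inner
    by (simp add: inner_diff_left inner_diff_right inner_commute algebra_simps)
  have "(h\<^sup>2 / 2 - 3 * \<rho> / (L * lmin * lmax * \<kappa>)) * (norm ((1 / h) *\<^sub>R (z - zh)))\<^sup>2
      = S\<^sup>2 / 2 - 3 * \<rho> / (L * lmin * lmax * \<kappa> * h\<^sup>2) * S\<^sup>2"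
  proof -
    have "(norm ((1 / h) *\<^sub>R (z - zh)))\<^sup>2 = S\<^sup>2 / h\<^sup>2"
      using h by (simp add: S_def power_divide)
    then show ?thesis using h by (simp only:) (simp add: left_diff_distrib diff_divide_distrib)
  qed
  moreover have "A \<le> V - V' + C + T + E"
    if "A = S' / 2 - R" "V' = V - S' + D + (X + Y)" "D \<le> S' / 2 + E" "X \<le> R + T" "Y \<le> C"
    for A C D E R S' T V V' X Y :: real
    using that by linarith
  ultimately show ?thesis using id gap weak cross by blast
qed

end

subsection \<open>Functions of finitely many samples\<close>

text \<open>Dependence on earlier samples is encoded by factoring through a tuple of them rather
  than by a filtration, because independence is available for restrictions to disjoint index
  sets.\<close>

definition determined_by ::
  "'w measure \<Rightarrow> ('i \<Rightarrow> 'w \<Rightarrow> 'a::euclidean_space) \<Rightarrow> 'i set \<Rightarrow> ('w \<Rightarrow> 'a) \<Rightarrow> bool" where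
  "determined_by M X A y \<longleftrightarrow> (\<exists>g \<in> borel_measurable (PiM A (\<lambda>_. borel)).
     \<forall>\<omega>\<in>space M. y \<omega> = g (restrict (\<lambda>i. X i \<omega>) A))"

lemma determined_by_const: "(\<And>\<omega>. \<omega> \<in> space M \<Longrightarrow> y \<omega> = a) \<Longrightarrow> determined_by M X A y"
  unfolding determined_by_def by (intro bexI[of _ "\<lambda>_. a"]) auto

lemma determined_by_mono:
  assumes "determined_by M X A y" "A \<subseteq> A'"
  shows "determined_by M X A' y"
proof -
  obtain g where g: "g \<in> borel_measurable (PiM A (\<lambda>_. borel))"
    "\<And>\<omega>. \<omega> \<in> space M \<Longrightarrow> y \<omega> = g (restrict (\<lambda>i. X i \<omega>) A)"
    using assms(1) by (auto simp: determined_by_def)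
  have "A' \<inter> A = A" using assms(2) by auto
  then have "y \<omega> = g (restrict (restrict (\<lambda>i. X i \<omega>) A') A)" if "\<omega> \<in> space M" for \<omega>
    using g(2)[OF that] by simp
  moreover have "(\<lambda>v. g (restrict v A)) \<in> borel_measurable (PiM A' (\<lambda>_. borel))"
    by (rule measurable_compose[OF measurable_restrict_subset[OF assms(2)] g(1)])
  ultimately show ?thesis
    unfolding determined_by_def by (intro bexI[of _ "\<lambda>v. g (restrict v A)"]) auto
qed

lemma determined_by_measurable:
  assumes "determined_by M X A y" "\<And>i. i \<in> A \<Longrightarrow> X i \<in> borel_measurable M"
  shows "y \<in> borel_measurable M"
proof -
  obtain g where g: "g \<in> borel_measurable (PiM A (\<lambda>_. borel))"
    "\<And>\<omega>. \<omega> \<in> space M \<Longrightarrow> y \<omega> = g (restrict (\<lambda>i. X i \<omega>) A)"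
    using assms(1) by (auto simp: determined_by_def)
  have "(\<lambda>\<omega>. restrict (\<lambda>i. X i \<omega>) A) \<in> measurable M (PiM A (\<lambda>_. borel))"
    using assms(2) by (intro measurable_restrict) auto
  from measurable_compose[OF this g(1)] show ?thesis
    by (subst measurable_cong[OF g(2)]) auto
qed

text \<open>Covers both half-steps: \<open>y\<close> is the current iterate for the extrapolation
  and the extrapolated point for the update.\<close>

lemma (in smoothing) determined_by_step:
  assumes z: "determined_by M X A z" and y: "determined_by M X A y" and Bt: "Bt \<subseteq> A"
    and Z: "compact Z" "Z \<noteq> {}" "convex Z"
    and p: "\<And>\<omega>. \<omega> \<in> space M \<Longrightarrow> p \<omega> = Proj B Z (z \<omega> - h *\<^sub>R (a *\<^sub>R (\<Sum>i\<in>Bt. G (y \<omega>) (X i \<omega>))))"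
  shows "determined_by M X A p"
proof -
  obtain gz where gz[measurable]: "gz \<in> borel_measurable (PiM A (\<lambda>_. borel))"
    and gz_eq: "\<And>\<omega>. \<omega> \<in> space M \<Longrightarrow> z \<omega> = gz (restrict (\<lambda>i. X i \<omega>) A)"
    using z by (auto simp: determined_by_def)
  obtain gy where gy[measurable]: "gy \<in> borel_measurable (PiM A (\<lambda>_. borel))"
    and gy_eq: "\<And>\<omega>. \<omega> \<in> space M \<Longrightarrow> y \<omega> = gy (restrict (\<lambda>i. X i \<omega>) A)"
    using y by (auto simp: determined_by_def)
  have [measurable]: "Proj B Z \<in> borel_measurable borel"
    by (rule borel_measurable_continuous_onI[OF continuous_Proj[OF Z]])
  have [measurable]: "(\<lambda>v. G (gy v) (v i)) \<in> borel_measurable (PiM A (\<lambda>_. borel))" if "i \<in> Bt" for i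
  proof -
    have "(\<lambda>v. (gy v, v i)) \<in> measurable (PiM A (\<lambda>_. borel)) ((borel::'a measure) \<Otimes>\<^sub>M (borel::'a measure))"
      using that Bt by (intro measurable_Pair gy measurable_component_singleton) auto
    from measurable_compose[OF this measurable_G] show ?thesis by simp
  qed
  define g where "g = (\<lambda>v. Proj B Z (gz v - h *\<^sub>R (a *\<^sub>R (\<Sum>i\<in>Bt. G (gy v) (v i)))))"
  have "g \<in> borel_measurable (PiM A (\<lambda>_. borel))"
    unfolding g_def by measurable
  moreover have "p \<omega> = g (restrict (\<lambda>i. X i \<omega>) A)" if "\<omega> \<in> space M" for \<omega>
  proof -
    have "(\<Sum>i\<in>Bt. G (y \<omega>) (X i \<omega>)) = (\<Sum>i\<in>Bt. G (y \<omega>) (restrict (\<lambda>i. X i \<omega>) A i))"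
      using Bt by (intro sum.cong) auto
    then show ?thesis by (simp add: p that g_def gz_eq gy_eq)
  qed
  ultimately show ?thesis unfolding determined_by_def by blast
qed

subsection \<open>The saddle operator\<close>

text \<open>\<open>grad\<close> is a definite description, so it can be evaluated only once
  gradients are unique; the test vector is \<open>D - E\<close>.\<close>

lemma GDERIV_unique:
  fixes f :: "'a::real_inner \<Rightarrow> real"
  assumes "GDERIV f x :> D" "GDERIV f x :> E"
  shows "D = E"
proof -
  have "(\<lambda>h. h \<bullet> D) = (\<lambda>h. h \<bullet> E)"
    using has_derivative_unique assms unfolding gderiv_def by blast
  then have "(D - E) \<bullet> D = (D - E) \<bullet> E" by (rule fun_cong)
  then have "(D - E) \<bullet> (D - E) = 0" by (simp add: inner_diff_right)
  then show ?thesis by simp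
qed

lemma grad_eqI: "GDERIV f x :> D \<Longrightarrow> grad f x = D"
  unfolding grad_def by (blast intro: GDERIV_unique)

text \<open>Riesz representation in coordinates: the gradient collects the values of the derivative
  on the basis.\<close>

lemma GDERIV_grad:
  fixes f :: "'a::euclidean_space \<Rightarrow> real"
  assumes "f differentiable (at x)"
  shows "GDERIV f x :> grad f x"
proof -
  obtain f' where f': "(f has_derivative f') (at x)"
    using assms by (auto simp: differentiable_def)
  define D where "D = (\<Sum>b\<in>Basis. f' b *\<^sub>R b)"
  have "f' h = h \<bullet> D" for h
  proof -
    have "f' h = f' (\<Sum>b\<in>Basis. (h \<bullet> b) *\<^sub>R b)" by (simp add: euclidean_representation)
    also have "\<dots> = (\<Sum>b\<in>Basis. (h \<bullet> b) * f' b)"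
      using has_derivative_linear[OF f'] by (simp add: linear_sum linear_scale)
    also have "\<dots> = h \<bullet> D" by (simp add: D_def inner_sum_right mult.commute)
    finally show ?thesis .
  qed
  then have "f' = (\<lambda>h. h \<bullet> D)" by (rule ext)
  then have "GDERIV f x :> D" using f' by (simp add: gderiv_def)
  then show ?thesis using grad_eqI by metis
qed

text \<open>Freezing one block composes \<open>f\<close> with an affine embedding of the other, and
  the chain rule picks out the corresponding block of \<open>D\<close>.\<close>

lemma saddle_op_eq:
  fixes f :: "(real^'n) \<times> (real^'m) \<Rightarrow> real"
  assumes "GDERIV f w :> D"
  shows "saddle_op f w = (fst D, - snd D)"
proof -
  have D: "(f has_derivative (\<lambda>h. h \<bullet> D)) (at (fst w, snd w))"
    using assms by (simp add: gderiv_def)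
  have "((\<lambda>x. (x, snd w)) has_derivative (\<lambda>h. (h, 0))) (at (fst w))"
    by (auto intro!: derivative_eq_intros)
  from has_derivative_compose[OF this D]
  have "GDERIV (\<lambda>x. f (x, snd w)) (fst w) :> fst D"
    by (simp add: gderiv_def inner_prod_def)
  moreover
  have "((\<lambda>y. (fst w, y)) has_derivative (\<lambda>h. (0, h))) (at (snd w))"
    by (auto intro!: derivative_eq_intros)
  from has_derivative_compose[OF this D]
  have "GDERIV (\<lambda>y. f (fst w, y)) (snd w) :> snd D"
    by (simp add: gderiv_def inner_prod_def)
  ultimately show ?thesis by (simp add: saddle_op_def grad_eqI)
qed

lemma symmetric_matrix_self_adjoint:
  fixes A :: "real^'n^'n"
  assumes "transpose A = A"
  shows "x \<bullet> (A *v y) = (A *v x) \<bullet> y"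
  by (metis assms dot_lmul_matrix transpose_matrix_vector)

lemma pos_def_op_block_diag:
  assumes "sym_pos_def B1" "sym_pos_def B2"
  shows "pos_def_op (block_diag B1 B2)"
proof (rule pos_def_op.intro)
  show "linear (block_diag B1 B2)"
    by (auto intro!: linearI simp: block_diag_def matrix_vector_right_distrib matrix_vector_mult_scaleR)
  show "x \<bullet> block_diag B1 B2 y = block_diag B1 B2 x \<bullet> y" for x y
    using assms by (simp add: block_diag_def inner_prod_def sym_pos_def_def symmetric_matrix_self_adjoint)
  show "0 < x \<bullet> block_diag B1 B2 x" if "x \<noteq> 0" for x
  proof -
    have "0 \<le> fst x \<bullet> (B1 *v fst x)" "0 \<le> snd x \<bullet> (B2 *v snd x)"
      using assms by (metis inner_zero_left less_imp_le order_refl sym_pos_def_def)+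
    moreover have "0 < fst x \<bullet> (B1 *v fst x) \<or> 0 < snd x \<bullet> (B2 *v snd x)"
      using that assms by (auto simp: prod_eq_iff sym_pos_def_def)
    ultimately show ?thesis by (auto simp: block_diag_def inner_prod_def)
  qed
qed

subsection \<open>Summation over the iterations\<close>

lemma telescoping_bound:
  fixes a v r :: "nat \<Rightarrow> real"
  assumes "\<And>k. k \<le> N \<Longrightarrow> c * a k \<le> v k - v (Suc k) + r k"
  shows "c * (\<Sum>k\<le>N. a k) \<le> v 0 - v (Suc N) + (\<Sum>k\<le>N. r k)"
  using assms
proof (induction N)
  case (Suc N)
  have "c * (\<Sum>k\<le>N. a k) \<le> v 0 - v (Suc N) + (\<Sum>k\<le>N. r k)" by (rule Suc.IH) (simp add: Suc.prems)
  then show ?case using Suc.prems[of "Suc N"] by (simp add: distrib_left)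
qed simp

text \<open>The bias found here is of order \<open>sqrt d\<close>; these estimates pass to the
  powers of \<open>d + 3\<close> in the rate. The factors 2 and 4 are those left after clearing
  denominators in \<open>rate_arithmetic\<close>.\<close>

lemma dimension_bounds:
  fixes d :: real
  assumes "1 \<le> d"
  shows "2 * sqrt d \<le> (d + 3) powr (3 / 2)" "4 * d \<le> (d + 3) ^ 3"
proof -
  have "2 * sqrt d \<le> (d + 3) * sqrt (d + 3)"
    using assms by (intro mult_mono) auto
  also have "\<dots> = (d + 3) powr 1 * (d + 3) powr (1 / 2)"
    using assms by (simp add: powr_half_sqrt)
  also have "\<dots> = (d + 3) powr (3 / 2)" by (simp only: powr_add[symmetric]) simp
  finally show "2 * sqrt d \<le> (d + 3) powr (3 / 2)" .
  have "4 * d \<le> (d + 3)\<^sup>2 * (d + 3)"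
    using assms power_mono[of 2 "d + 3" 2] by (intro mult_mono) auto
  then show "4 * d \<le> (d + 3) ^ 3" by (simp add: power3_eq_cube power2_eq_square)
qed

lemma rate_arithmetic:
  fixes L lmin lmax \<kappa> \<rho> h D \<mu> d \<sigma> V A T1 T2 n :: real
  assumes pos: "0 < L" "0 < lmin" "0 < lmax" "0 < \<kappa>" "0 < h" "0 < n" "0 \<le> \<rho>" "0 \<le> D" "0 < \<mu>" "0 \<le> \<sigma>" "0 \<le> T1"
    and d: "1 \<le> d" and h: "6 * \<rho> < L * h\<^sup>2 * lmin * lmax * \<kappa>"
    and le: "(h\<^sup>2 / 2 - 3 * \<rho> / (L * lmin * lmax * \<kappa>)) * A
      \<le> V + n * (D / (L * lmax) * (\<mu> * L * sqrt d) + 2 * \<rho> * \<kappa> / (L * lmax) * (\<mu> * L * sqrt d)\<^sup>2)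
        + (2 * \<rho> * \<kappa> / (L * lmax) + 2 / (L\<^sup>2 * \<kappa> * lmax)) * \<sigma>\<^sup>2 * T1 + D / (L * lmax) * \<sigma> * T2"
  defines "E \<equiv> L * h\<^sup>2 * lmin * lmax * \<kappa> - 6 * \<rho>"
  shows "1 / n * A \<le> 2 * L * lmin * lmax * \<kappa> * V / (E * n)
      + \<mu> * D * lmin * \<kappa> * L * (d + 3) powr (3 / 2) / E
      + \<mu>\<^sup>2 * \<rho> * lmin * \<kappa>\<^sup>2 * L\<^sup>2 * (d + 3) ^ 3 / E
      + (36 * \<rho> * \<kappa>\<^sup>2 * lmin + 4 * lmin / L) * \<sigma>\<^sup>2 / E * (1 / n * T1)
      + 2 * D * lmin * \<kappa> * \<sigma> / E * (1 / n * T2)"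
proof -
  have E: "0 < E" using h by (simp add: E_def)
  \<comment> \<open>The multiplier that clears the denominators of the step bound: the coefficient
    of \<open>A\<close> is \<open>E / W\<close>, so the claim follows after multiplying by
    \<open>W\<close> and dividing by \<open>E * n\<close>.\<close>
  define W where "W = 2 * L * lmin * lmax * \<kappa>"
  have W: "0 < W" using pos by (simp add: W_def)
  have c: "h\<^sup>2 / 2 - 3 * \<rho> / (L * lmin * lmax * \<kappa>) = E / W"
    using pos by (simp add: E_def W_def field_simps)
  have W1: "W * (D / (L * lmax)) = 2 * D * lmin * \<kappa>"
    "W * (2 * \<rho> * \<kappa> / (L * lmax)) = 4 * \<rho> * \<kappa>\<^sup>2 * lmin"
    "W * (2 / (L\<^sup>2 * \<kappa> * lmax)) = 4 * lmin / L"
    using pos by (simp_all add: W_def field_simps power2_eq_square)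
  have "E * A = W * (E / W * A)" using W by simp
  also have "\<dots> \<le> W * (V + n * (D / (L * lmax) * (\<mu> * L * sqrt d) + 2 * \<rho> * \<kappa> / (L * lmax) * (\<mu> * L * sqrt d)\<^sup>2)
        + (2 * \<rho> * \<kappa> / (L * lmax) + 2 / (L\<^sup>2 * \<kappa> * lmax)) * \<sigma>\<^sup>2 * T1 + D / (L * lmax) * \<sigma> * T2)"
    using le W unfolding c by (intro mult_left_mono) auto
  also have "\<dots> = W * V + n * (W * (D / (L * lmax)) * (\<mu> * L * sqrt d)
        + W * (2 * \<rho> * \<kappa> / (L * lmax)) * (\<mu> * L * sqrt d)\<^sup>2)
        + (W * (2 * \<rho> * \<kappa> / (L * lmax)) + W * (2 / (L\<^sup>2 * \<kappa> * lmax))) * \<sigma>\<^sup>2 * T1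
        + W * (D / (L * lmax)) * \<sigma> * T2"
    by algebra
  also have "\<dots> = W * V + n * (\<mu> * D * lmin * \<kappa> * L * (2 * sqrt d) + \<mu>\<^sup>2 * \<rho> * lmin * \<kappa>\<^sup>2 * L\<^sup>2 * (4 * d))
        + (4 * \<rho> * \<kappa>\<^sup>2 * lmin + 4 * lmin / L) * \<sigma>\<^sup>2 * T1 + 2 * D * lmin * \<kappa> * \<sigma> * T2"
    unfolding W1 using d by (simp add: power_mult_distrib mult_ac)
  \<comment> \<open>Besides the dimension bounds, the coefficient \<open>4 * \<rho>\<close> of the
    variance term is enlarged to \<open>36 * \<rho>\<close>.\<close>
  also have "\<dots> \<le> W * V + n * (\<mu> * D * lmin * \<kappa> * L * (d + 3) powr (3 / 2)
          + \<mu>\<^sup>2 * \<rho> * lmin * \<kappa>\<^sup>2 * L\<^sup>2 * (d + 3) ^ 3)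
        + (36 * \<rho> * \<kappa>\<^sup>2 * lmin + 4 * lmin / L) * \<sigma>\<^sup>2 * T1 + 2 * D * lmin * \<kappa> * \<sigma> * T2"
    using dimension_bounds[OF d] pos
    by (intro add_mono mult_left_mono mult_right_mono order_refl) auto
  finally have "A \<le> (W * V + n * (\<mu> * D * lmin * \<kappa> * L * (d + 3) powr (3 / 2)
          + \<mu>\<^sup>2 * \<rho> * lmin * \<kappa>\<^sup>2 * L\<^sup>2 * (d + 3) ^ 3)
        + (36 * \<rho> * \<kappa>\<^sup>2 * lmin + 4 * lmin / L) * \<sigma>\<^sup>2 * T1 + 2 * D * lmin * \<kappa> * \<sigma> * T2) / E"
    using E by (simp add: pos_le_divide_eq mult.commute)
  then have "1 / n * A \<le> 1 / n * ((W * V + n * (\<mu> * D * lmin * \<kappa> * L * (d + 3) powr (3 / 2)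
          + \<mu>\<^sup>2 * \<rho> * lmin * \<kappa>\<^sup>2 * L\<^sup>2 * (d + 3) ^ 3)
        + (36 * \<rho> * \<kappa>\<^sup>2 * lmin + 4 * lmin / L) * \<sigma>\<^sup>2 * T1 + 2 * D * lmin * \<kappa> * \<sigma> * T2) / E)"
    using pos by (intro mult_left_mono) auto
  also have "\<dots> = W * V / (E * n) + \<mu> * D * lmin * \<kappa> * L * (d + 3) powr (3 / 2) / E
      + \<mu>\<^sup>2 * \<rho> * lmin * \<kappa>\<^sup>2 * L\<^sup>2 * (d + 3) ^ 3 / E
      + (36 * \<rho> * \<kappa>\<^sup>2 * lmin + 4 * lmin / L) * \<sigma>\<^sup>2 / E * (1 / n * T1)
      + 2 * D * lmin * \<kappa> * \<sigma> / E * (1 / n * T2)"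
    using \<open>0 < n\<close> by (simp add: add_divide_distrib distrib_left mult.commute)
  finally show ?thesis by (simp add: W_def)
qed

section \<open>Expected step bounds and the resulting rate\<close>

theorem theorem4:
  fixes B1 :: "real^'n^'n" and B2 :: "real^'m^'m"
    and B :: "(real^'n) \<times> (real^'m) \<Rightarrow> (real^'n) \<times> (real^'m)"
    and f :: "(real^'n) \<times> (real^'m) \<Rightarrow> real"
    and X :: "(real^'n) set" and Y :: "(real^'m) set" and Z :: "((real^'n) \<times> (real^'m)) set"
    and lmin lmax \<kappa> L1 \<mu> \<sigma> \<rho> h Dz d :: real
    and zstar z0 :: "(real^'n) \<times> (real^'m)"
    and t :: "nat \<Rightarrow> nat" and N :: nat
    and M :: "'w measure"
    and uhat u :: "nat \<Rightarrow> nat \<Rightarrow> 'w \<Rightarrow> (real^'n) \<times> (real^'m)"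
    and z zhat s :: "nat \<Rightarrow> 'w \<Rightarrow> (real^'n) \<times> (real^'m)"
  assumes B1: "sym_pos_def B1" and B2: "sym_pos_def B2"
    and B: "B = block_diag B1 B2"
    and lmin: "lmin = Min (eigenvalues B)" and lmax: "lmax = Max (eigenvalues B)"
    and kappa: "\<kappa> = lmax / lmin"
    and d: "d = real (CARD('n) + CARD('m))"
    and f_diff: "\<And>w. f differentiable (at w)"
    and f_C1: "continuous_on UNIV (grad f)"
    and L1_pos: "L1 > 0"
    and f_Lipschitz: "\<And>w1 w2. wnorm_dual B (grad f w1 - grad f w2) \<le> L1 * wnorm B (w1 - w2)"
    and Z: "Z = X \<times> Y" and Z_nonempty: "Z \<noteq> {}" and Z_compact: "compact Z" and Z_convex: "convex Z"
    and Dz: "Dz = wdiameter B Z"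
    and mu_pos: "\<mu> > 0"
    and sigma_nonneg: "\<sigma> \<ge> 0"
    and variance: "\<And>w. (\<integral>v. (wnorm_dual B (oracle_G B1 B2 \<mu> f w v
                          - saddle_op (gauss_smoothing B1 B2 \<mu> f) w))\<^sup>2 \<partial>gaussian B1 B2) \<le> \<sigma>\<^sup>2"
    and rho: "0 \<le> \<rho>" "\<rho> < 1 / (24 * L1 * \<kappa>\<^sup>2)"
    and zstar: "zstar \<in> Z"
    and MVI: "prox_weak_MVI B Z (saddle_op f) \<rho> zstar"
    and z0: "z0 \<in> Z"
    and t: "\<And>k. t k \<ge> 1"
    and h: "h > 0" "sqrt (6 * \<rho> / (L1 * \<kappa> * lmax * lmin)) < h" "h \<le> 1 / (2 * L1 * \<kappa> * lmax)"
    and samples: "gaussian_samples M B1 B2 t N uhat u"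
    and algorithm: "\<And>\<omega>. \<omega> \<in> space M \<Longrightarrow>
          vr_zo_eg B1 B2 \<mu> f Z (\<lambda>_. h) (\<lambda>_. h) t N z0
            (\<lambda>k i. uhat k i \<omega>) (\<lambda>k i. u k i \<omega>) (\<lambda>k. z k \<omega>) (\<lambda>k. zhat k \<omega>)"
    and s: "\<And>k \<omega>. s k \<omega> =
          prox_map B Z (z k \<omega>) h (avg_oracle B1 B2 \<mu> f (t k) (z k \<omega>) (\<lambda>i. uhat k i \<omega>))"
  shows "1 / (real N + 1) * (\<Sum>k\<le>N. (\<integral>\<omega>. (norm (s k \<omega>))\<^sup>2 \<partial>M))
    \<le> 2 * L1 * lmin * lmax * \<kappa> * (norm (z0 - zstar))\<^sup>2
          / ((L1 * h\<^sup>2 * lmin * lmax * \<kappa> - 6 * \<rho>) * (real N + 1))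
      + \<mu> * Dz * lmin * \<kappa> * L1 * (d + 3) powr (3 / 2) / (L1 * h\<^sup>2 * lmin * lmax * \<kappa> - 6 * \<rho>)
      + \<mu>\<^sup>2 * \<rho> * lmin * \<kappa>\<^sup>2 * L1\<^sup>2 * (d + 3) ^ 3 / (L1 * h\<^sup>2 * lmin * lmax * \<kappa> - 6 * \<rho>)
      + (36 * \<rho> * \<kappa>\<^sup>2 * lmin + 4 * lmin / L1) * \<sigma>\<^sup>2 / (L1 * h\<^sup>2 * lmin * lmax * \<kappa> - 6 * \<rho>)
          * (1 / (real N + 1) * (\<Sum>k\<le>N. 1 / real (t k)))
      + 2 * Dz * lmin * \<kappa> * \<sigma> / (L1 * h\<^sup>2 * lmin * lmax * \<kappa> - 6 * \<rho>)
          * (1 / (real N + 1) * (\<Sum>k\<le>N. 1 / sqrt (real (t k))))"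
proof -
  define J :: "(real^'n) \<times> (real^'m) \<Rightarrow> (real^'n) \<times> (real^'m)" where "J p = (fst p, - snd p)" for p
  define P where "P = gaussian B1 B2"
  define c where "c = sqrt (det B1 * det B2 / (2 * pi) ^ (CARD('n) + CARD('m)))"
  define I where "I = {(b::bool, k, i). k \<le> N \<and> i \<in> {1..t k}}"
  define W where "W = (\<lambda>(b, k, i). if b then uhat k i else u k i)"
  have M: "prob_space M"
    and ind: "prob_space.indep_vars M (\<lambda>_. borel) W I"
    and law: "\<And>j. j \<in> I \<Longrightarrow> distr M borel (W j) = P"
    using samples by (auto simp: gaussian_samples_def I_def W_def P_def)
  interpret M: prob_space M by (rule M)
  have W_meas: "W j \<in> borel_measurable M" if "j \<in> I" for j
    using ind that by (auto simp: M.indep_vars_def)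
  \<comment> \<open>Batches are nonempty, so \<open>P\<close> is the law of an actual random vector
    and has total mass one.\<close>
  have "(True, 0, 1) \<in> I" using t[of 0] by (auto simp: I_def)
  then have P_prob: "prob_space P"
    using law W_meas M.prob_space_distr by metis
  interpret pd: pos_def_op B
    unfolding B by (rule pos_def_op_block_diag[OF B1 B2])
  interpret bd: pos_def_op_bounds B lmin lmax
    by unfold_locales
      (simp_all add: lmin lmax pd.Min_eigenvalue_pos pd.Min_le_Max_eigenvalue pd.Min_eigenvalue_le pd.le_Max_eigenvalue)
  have J_lin: "linear J" by (auto intro!: linearI simp: J_def)
  have J_norm: "norm (J x) = norm x" for x by (simp add: J_def norm_prod_def)
  \<comment> \<open>The reflection commutes with \<open>B\<close> because \<open>B\<close> is block
    diagonal, hence also with its inverse.\<close>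
  have J_dual: "wnorm_dual B (J x) = wnorm_dual B x" for x
  proof -
    have "B (J y) = J (B y)" for y
      by (simp add: B block_diag_def J_def linear_neg[OF matrix_vector_mul_linear])
    then have "inv B (J x) = J (inv B x)"
      by (metis pd.B_inv pd.inv_B)
    then show ?thesis by (simp add: wnorm_dual_def J_def inner_prod_def)
  qed
  interpret sm: smoothing B lmin lmax c P f "grad f" J L1 \<mu>
  proof (intro smoothing.intro gaussian_law.intro smoothing_axioms.intro gaussian_law_axioms.intro)
    show "pos_def_op_bounds B lmin lmax" by (rule bd.pos_def_op_bounds_axioms)
    show "P = density lborel (\<lambda>u. ennreal (c * exp (- (u \<bullet> B u) / 2)))"
      by (simp add: P_def c_def B gaussian_def)
    show "prob_space P" by (rule P_prob)
    show "GDERIV f w :> grad f w" for w by (rule GDERIV_grad[OF f_diff])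
    show "wnorm_dual B (grad f v - grad f w) \<le> L1 * wnorm B (v - w)" for v w by (rule f_Lipschitz)
    show "0 \<le> L1" using L1_pos by simp
  qed (rule mu_pos J_lin J_norm J_dual)+
  have F_eq: "saddle_op f = sm.F"
  proof
    show "saddle_op f w = sm.F w" for w
      unfolding saddle_op_eq[OF GDERIV_grad[OF f_diff[of w]]] sm.F_def J_def ..
  qed
  have Fs_eq: "saddle_op (gauss_smoothing B1 B2 \<mu> f) = sm.F\<mu>"
  proof
    fix w
    show "saddle_op (gauss_smoothing B1 B2 \<mu> f) w = sm.F\<mu> w"
      unfolding gauss_smoothing_def[abs_def] P_def[symmetric]
        saddle_op_eq[OF sm.GDERIV_smoothing[of w]] sm.F\<mu>_def J_def ..
  qed
  have G_eq: "oracle_G B1 B2 \<mu> f = sm.G"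
  proof (intro ext)
    show "oracle_G B1 B2 \<mu> f w v = sm.G w v" for w v
      unfolding oracle_G_def sm.G_def J_def by (simp add: B block_diag_def)
  qed
  have var: "(\<integral>v. (wnorm_dual B (sm.G w v - sm.F\<mu> w))\<^sup>2 \<partial>P) \<le> \<sigma>\<^sup>2" for w
    using variance[of w] by (simp add: G_eq Fs_eq P_def)
  define H where "H b k = (\<lambda>i. (b::bool, k::nat, i)) ` {1..t k}" for b k
  \<comment> \<open>Both batches of every iteration strictly before \<open>k\<close>; the two
    batches of iteration \<open>k\<close> stay apart in \<open>H\<close>, since disjoint index sets
    are what independence requires.\<close>
  define past where "past k = {(b::bool, j, i). j < k \<and> i \<in> {1..t j}}" for k
  have H: "finite (H b k)" "H b k \<noteq> {}" "card (H b k) = t k" for b k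
    using t[of k] by (auto simp: H_def card_image inj_on_def)
  have H_sum: "(\<Sum>j\<in>H b k. g j) = (\<Sum>i=1..t k. g (b, k, i))" for b k and g :: "_ \<Rightarrow> (real^'n) \<times> (real^'m)"
    unfolding H_def by (subst sum.reindex) (auto simp: inj_on_def)
  define ah where "ah k \<omega> = (1 / real (t k)) *\<^sub>R (\<Sum>j\<in>H True k. sm.G (z k \<omega>) (W j \<omega>))" for k \<omega>
  define a where "a k \<omega> = (1 / real (t k)) *\<^sub>R (\<Sum>j\<in>H False k. sm.G (zhat k \<omega>) (W j \<omega>))" for k \<omega>
  have ah_eq: "avg_oracle B1 B2 \<mu> f (t k) (z k \<omega>) (\<lambda>i. uhat k i \<omega>) = ah k \<omega>" for k \<omega>
    by (simp add: avg_oracle_def ah_def H_sum W_def G_eq)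
  have a_eq: "avg_oracle B1 B2 \<mu> f (t k) (zhat k \<omega>) (\<lambda>i. u k i \<omega>) = a k \<omega>" for k \<omega>
    by (simp add: avg_oracle_def a_def H_sum W_def G_eq)
  have z_0: "z 0 \<omega> = z0" if "\<omega> \<in> space M" for \<omega>
    using algorithm[OF that] by (simp add: vr_zo_eg_def)
  have zhat_eq: "zhat k \<omega> = Proj B Z (z k \<omega> - h *\<^sub>R ah k \<omega>)" if "\<omega> \<in> space M" "k \<le> N" for k \<omega>
    using algorithm[OF that(1)] that(2) by (simp add: vr_zo_eg_def ah_eq B)
  have z_Suc: "z (Suc k) \<omega> = Proj B Z (z k \<omega> - h *\<^sub>R a k \<omega>)" if "\<omega> \<in> space M" "k \<le> N" for k \<omega>
    using algorithm[OF that(1)] that(2) by (simp add: vr_zo_eg_def a_eq B)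
  have s_eq: "s k \<omega> = (1 / h) *\<^sub>R (z k \<omega> - zhat k \<omega>)" if "\<omega> \<in> space M" "k \<le> N" for k \<omega>
    by (simp add: s prox_map_def ah_eq zhat_eq[OF that])
  note Zs = Z_compact Z_nonempty Z_convex
  have z_in: "z k \<omega> \<in> Z" if "\<omega> \<in> space M" "k \<le> Suc N" for k \<omega>
    using that z0 by (cases k) (auto simp: z_0 z_Suc intro: pd.Proj_minimal(1)[OF Zs(1,2)])
  have zhat_in: "zhat k \<omega> \<in> Z" if "\<omega> \<in> space M" "k \<le> N" for k \<omega>
    using that by (auto simp: zhat_eq intro: pd.Proj_minimal(1)[OF Zs(1,2)])

  \<comment> \<open>Conditional on the statement for \<open>z k\<close>, because the two sequences
    depend on each other alternately; the induction below supplies the premise.\<close>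
  have det_hat: "determined_by M W (past k \<union> H True k) (zhat k)"
    if "determined_by M W (past k) (z k)" "k \<le> N" for k
    by (rule sm.determined_by_step[OF determined_by_mono[OF that(1)] determined_by_mono[OF that(1)] _ Zs,
          where Bt = "H True k" and a = "1 / real (t k)" and h = h])
      (use that(2) in \<open>auto simp: zhat_eq ah_def\<close>)
  have det_z: "determined_by M W (past k) (z k)" if "k \<le> Suc N" for k
    using that
  proof (induction k)
    case 0
    then show ?case by (intro determined_by_const[where a = z0] z_0)
  next
    case (Suc k)
    then have z: "determined_by M W (past k) (z k)" and k: "k \<le> N" by auto
    have sub: "past k \<subseteq> past (Suc k)" "past k \<union> H True k \<subseteq> past (Suc k)" "H False k \<subseteq> past (Suc k)"
      by (auto simp: past_def H_def)
    show ?case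
      by (rule sm.determined_by_step[OF determined_by_mono[OF z sub(1)] determined_by_mono[OF det_hat[OF z k] sub(2)]
            sub(3) Zs, where a = "1 / real (t k)" and h = h])
        (use k in \<open>auto simp: z_Suc a_def\<close>)
  qed

  define n1 where "n1 k \<omega> = wnorm_dual B (ah k \<omega> - sm.F\<mu> (z k \<omega>))" for k \<omega>
  define n2 where "n2 k \<omega> = wnorm_dual B (a k \<omega> - sm.F\<mu> (zhat k \<omega>))" for k \<omega>
  have noise1: "integrable M (n1 k)" "integrable M (\<lambda>\<omega>. (n1 k \<omega>)\<^sup>2)"
      "(\<integral>\<omega>. (n1 k \<omega>)\<^sup>2 \<partial>M) \<le> \<sigma>\<^sup>2 / real (t k)" if k: "k \<le> N" for k
  proof -
    obtain g where g: "g \<in> borel_measurable (PiM (past k) (\<lambda>_. borel))"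
      "\<And>\<omega>. \<omega> \<in> space M \<Longrightarrow> z k \<omega> = g (restrict (\<lambda>i. W i \<omega>) (past k))"
      using det_z[of k] k by (auto simp: determined_by_def)
    have AI: "past k \<inter> H True k = {}" "past k \<subseteq> I" "H True k \<subseteq> I"
      using k by (auto simp: past_def H_def I_def)
    have law': "distr M borel (W j) = P" if "j \<in> H True k" for j using law AI(3) that by blast
    note * = sm.adaptive_batch_noise[OF M ind AI H(1,2) law' g sigma_nonneg var, unfolded H(3)]
    show "integrable M (n1 k)" "integrable M (\<lambda>\<omega>. (n1 k \<omega>)\<^sup>2)"
      "(\<integral>\<omega>. (n1 k \<omega>)\<^sup>2 \<partial>M) \<le> \<sigma>\<^sup>2 / real (t k)"
      using *(1-3) by (simp_all add: n1_def[abs_def] ah_def)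
  qed
  have noise2: "integrable M (n2 k)" "integrable M (\<lambda>\<omega>. (n2 k \<omega>)\<^sup>2)"
      "(\<integral>\<omega>. (n2 k \<omega>)\<^sup>2 \<partial>M) \<le> \<sigma>\<^sup>2 / real (t k)" "(\<integral>\<omega>. n2 k \<omega> \<partial>M) \<le> \<sigma> / sqrt (real (t k))" if k: "k \<le> N" for k
  proof -
    \<comment> \<open>The extrapolated point has already used the first batch of its own iteration;
      the second batch is fresh and still disjoint from \<open>A\<close>.\<close>
    define A where "A = past k \<union> H True k"
    have "determined_by M W A (zhat k)" unfolding A_def using det_hat det_z k by simp
    then obtain g where g: "g \<in> borel_measurable (PiM A (\<lambda>_. borel))"
      "\<And>\<omega>. \<omega> \<in> space M \<Longrightarrow> zhat k \<omega> = g (restrict (\<lambda>i. W i \<omega>) A)"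
      by (auto simp: determined_by_def)
    have AI: "A \<inter> H False k = {}" "A \<subseteq> I" "H False k \<subseteq> I"
      using k by (auto simp: A_def past_def H_def I_def)
    have law': "distr M borel (W j) = P" if "j \<in> H False k" for j using law AI(3) that by blast
    note * = sm.adaptive_batch_noise[OF M ind AI H(1,2) law' g sigma_nonneg var, unfolded H(3)]
    show "integrable M (n2 k)" "integrable M (\<lambda>\<omega>. (n2 k \<omega>)\<^sup>2)"
      "(\<integral>\<omega>. (n2 k \<omega>)\<^sup>2 \<partial>M) \<le> \<sigma>\<^sup>2 / real (t k)" "(\<integral>\<omega>. n2 k \<omega> \<partial>M) \<le> \<sigma> / sqrt (real (t k))"
      using * by (simp_all add: n2_def[abs_def] a_def)
  qed

  have kappa1: "0 < \<kappa>" using bd.lmin_pos bd.lmax_pos by (simp add: kappa)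
  define b where "b = \<mu> * L1 * sqrt d"
  define c0 where "c0 = h\<^sup>2 / 2 - 3 * \<rho> / (L1 * lmin * lmax * \<kappa>)"
  define \<alpha> where "\<alpha> = Dz / (L1 * lmax)"
  define \<beta> where "\<beta> = 2 * \<rho> * \<kappa> / (L1 * lmax)"
  define \<gamma> where "\<gamma> = 1 / (L1\<^sup>2 * \<kappa> * lmax)"
  have Dz0: "0 \<le> Dz"
    unfolding Dz by (rule order_trans[OF pd.wnorm_nonneg pd.wnorm_le_wdiameter[OF Zs(1) z0 z0]])
  have coeffs: "0 \<le> \<alpha>" "0 \<le> \<beta>" "0 \<le> \<gamma>"
    using Dz0 L1_pos bd.lmax_pos rho kappa1 by (auto simp: \<alpha>_def \<beta>_def \<gamma>_def)
  have bias: "wnorm_dual B (sm.F\<mu> w - sm.F w) \<le> b" for w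
    using sm.smoothing_bias[of w] by (simp add: b_def d)
  have step: "c0 * (norm (s k \<omega>))\<^sup>2 \<le> (norm (z k \<omega> - zstar))\<^sup>2 - (norm (z (Suc k) \<omega> - zstar))\<^sup>2
      + \<alpha> * (n2 k \<omega> + b) + \<beta> * ((n1 k \<omega>)\<^sup>2 + b\<^sup>2) + \<gamma> * ((n1 k \<omega>)\<^sup>2 + (n2 k \<omega>)\<^sup>2)"
    if \<omega>: "\<omega> \<in> space M" and k: "k \<le> N" for k \<omega>
    using bd.extragradient_step[OF Zs sm.F_Lipschitz sm.F\<mu>_Lipschitz bias L1_pos kappa h(1) h(3) rho(1)
        MVI[unfolded F_eq] zstar z_in[OF \<omega>, of k], of "ah k \<omega>" "a k \<omega>"] k
    by (simp only: c0_def \<alpha>_def \<beta>_def \<gamma>_def n1_def n2_def s_eq[OF \<omega> k] z_Suc[OF \<omega> k] zhat_eq[OF \<omega> k]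
        Dz le_SucI simp_thms)

  \<comment> \<open>Boundedness of \<open>Z\<close> makes all squared distances between iterates
    integrable, so expectations may be taken termwise.\<close>
  obtain R where R: "\<And>x. x \<in> Z \<Longrightarrow> norm x \<le> R"
    using compact_imp_bounded[OF Z_compact] by (auto simp: bounded_iff)
  have bounded_diff: "(norm (x - y))\<^sup>2 \<le> (2 * R)\<^sup>2" if "x \<in> Z" "y \<in> Z" for x y
    using norm_triangle_ineq4[of x y] R[OF that(1)] R[OF that(2)] by (intro power_mono) auto
  have z_meas: "z k \<in> borel_measurable M" if "k \<le> Suc N" for k
    using that by (intro determined_by_measurable[OF det_z] W_meas) (auto simp: past_def I_def)
  have zhat_meas: "zhat k \<in> borel_measurable M" if "k \<le> N" for k
    using that by (intro determined_by_measurable[OF det_hat[OF det_z]] W_meas) (auto simp: past_def H_def I_def)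
  have V_int: "integrable M (\<lambda>\<omega>. (norm (z k \<omega> - zstar))\<^sup>2)" if "k \<le> Suc N" for k
  proof (rule M.integrable_const_bound[where B = "(2 * R)\<^sup>2"])
    show "AE \<omega> in M. norm ((norm (z k \<omega> - zstar))\<^sup>2) \<le> (2 * R)\<^sup>2"
      using bounded_diff[OF z_in[OF _ that] zstar] by (intro AE_I2) simp
  qed (use z_meas[OF that] in measurable)
  have s_int: "integrable M (\<lambda>\<omega>. (norm (s k \<omega>))\<^sup>2)" if "k \<le> N" for k
  proof -
    have [measurable]: "z k \<in> borel_measurable M" "zhat k \<in> borel_measurable M"
      using z_meas zhat_meas that by auto
    have "integrable M (\<lambda>\<omega>. (norm (z k \<omega> - zhat k \<omega>))\<^sup>2)"
    proof (rule M.integrable_const_bound[where B = "(2 * R)\<^sup>2"])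
      show "AE \<omega> in M. norm ((norm (z k \<omega> - zhat k \<omega>))\<^sup>2) \<le> (2 * R)\<^sup>2"
        using bounded_diff[OF z_in zhat_in] that by (intro AE_I2) simp
    qed measurable
    then have "integrable M (\<lambda>\<omega>. (1 / h)\<^sup>2 * (norm (z k \<omega> - zhat k \<omega>))\<^sup>2)" by simp
    then show ?thesis
      by (subst Bochner_Integration.integrable_cong[OF refl]) (auto simp: s_eq that power_mult_distrib power_divide)
  qed

  \<comment> \<open>The coefficient \<open>\<beta>\<close> meets the first batch only,
    \<open>\<gamma>\<close> meets both, whence \<open>\<beta> + 2 * \<gamma>\<close>; the
    first-order noise of the second batch gives the last term.\<close>
  define r where "r k = (\<alpha> * b + \<beta> * b\<^sup>2) + (\<beta> + 2 * \<gamma>) * \<sigma>\<^sup>2 * (1 / real (t k)) + \<alpha> * \<sigma> * (1 / sqrt (real (t k)))" for k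
  have "c0 * (\<integral>\<omega>. (norm (s k \<omega>))\<^sup>2 \<partial>M)
      \<le> (\<integral>\<omega>. (norm (z k \<omega> - zstar))\<^sup>2 \<partial>M) - (\<integral>\<omega>. (norm (z (Suc k) \<omega> - zstar))\<^sup>2 \<partial>M) + r k"
    if k: "k \<le> N" for k
  proof -
    note ints = V_int[of k] V_int[of "Suc k"] noise1[OF k] noise2[OF k] s_int[OF k]
    have "c0 * (\<integral>\<omega>. (norm (s k \<omega>))\<^sup>2 \<partial>M) = (\<integral>\<omega>. c0 * (norm (s k \<omega>))\<^sup>2 \<partial>M)" by simp
    also have "\<dots> \<le> (\<integral>\<omega>. (norm (z k \<omega> - zstar))\<^sup>2 - (norm (z (Suc k) \<omega> - zstar))\<^sup>2
      + \<alpha> * (n2 k \<omega> + b) + \<beta> * ((n1 k \<omega>)\<^sup>2 + b\<^sup>2) + \<gamma> * ((n1 k \<omega>)\<^sup>2 + (n2 k \<omega>)\<^sup>2) \<partial>M)"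
      using k ints by (intro integral_mono step) auto
    also have "\<dots> = (\<integral>\<omega>. (norm (z k \<omega> - zstar))\<^sup>2 \<partial>M) - (\<integral>\<omega>. (norm (z (Suc k) \<omega> - zstar))\<^sup>2 \<partial>M)
      + \<alpha> * ((\<integral>\<omega>. n2 k \<omega> \<partial>M) + b) + \<beta> * ((\<integral>\<omega>. (n1 k \<omega>)\<^sup>2 \<partial>M) + b\<^sup>2)
      + \<gamma> * ((\<integral>\<omega>. (n1 k \<omega>)\<^sup>2 \<partial>M) + (\<integral>\<omega>. (n2 k \<omega>)\<^sup>2 \<partial>M))"
      using k ints M.prob_space by simp
    also have "\<dots> \<le> (\<integral>\<omega>. (norm (z k \<omega> - zstar))\<^sup>2 \<partial>M) - (\<integral>\<omega>. (norm (z (Suc k) \<omega> - zstar))\<^sup>2 \<partial>M)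
      + \<alpha> * (\<sigma> / sqrt (real (t k)) + b) + \<beta> * (\<sigma>\<^sup>2 / real (t k) + b\<^sup>2)
      + \<gamma> * (\<sigma>\<^sup>2 / real (t k) + \<sigma>\<^sup>2 / real (t k))"
      using ints coeffs by (intro add_mono mult_left_mono order_refl) auto
    also have "\<dots> = (\<integral>\<omega>. (norm (z k \<omega> - zstar))\<^sup>2 \<partial>M) - (\<integral>\<omega>. (norm (z (Suc k) \<omega> - zstar))\<^sup>2 \<partial>M) + r k"
      by (simp add: r_def algebra_simps)
    finally show ?thesis .
  qed
  then have "c0 * (\<Sum>k\<le>N. \<integral>\<omega>. (norm (s k \<omega>))\<^sup>2 \<partial>M)
      \<le> (\<integral>\<omega>. (norm (z 0 \<omega> - zstar))\<^sup>2 \<partial>M) - (\<integral>\<omega>. (norm (z (Suc N) \<omega> - zstar))\<^sup>2 \<partial>M) + (\<Sum>k\<le>N. r k)"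
    by (rule telescoping_bound[where v = "\<lambda>k. \<integral>\<omega>. (norm (z k \<omega> - zstar))\<^sup>2 \<partial>M"])
  moreover have "(\<integral>\<omega>. (norm (z 0 \<omega> - zstar))\<^sup>2 \<partial>M) = (norm (z0 - zstar))\<^sup>2"
  proof -
    have "(\<integral>\<omega>. (norm (z 0 \<omega> - zstar))\<^sup>2 \<partial>M) = (\<integral>\<omega>. (norm (z0 - zstar))\<^sup>2 \<partial>M)"
      by (rule Bochner_Integration.integral_cong) (simp_all add: z_0)
    then show ?thesis using M.prob_space by simp
  qed
  moreover have "0 \<le> (\<integral>\<omega>. (norm (z (Suc N) \<omega> - zstar))\<^sup>2 \<partial>M)" by simp
  moreover have "(\<Sum>k\<le>N. r k) = (real N + 1) * (\<alpha> * b + \<beta> * b\<^sup>2)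
      + (\<beta> + 2 * \<gamma>) * \<sigma>\<^sup>2 * (\<Sum>k\<le>N. 1 / real (t k)) + \<alpha> * \<sigma> * (\<Sum>k\<le>N. 1 / sqrt (real (t k)))"
    unfolding r_def sum.distrib sum_distrib_left[symmetric] by (simp add: algebra_simps)
  ultimately have total: "c0 * (\<Sum>k\<le>N. \<integral>\<omega>. (norm (s k \<omega>))\<^sup>2 \<partial>M)
      \<le> (norm (z0 - zstar))\<^sup>2 + (real N + 1) * (\<alpha> * b + \<beta> * b\<^sup>2)
        + (\<beta> + 2 * \<gamma>) * \<sigma>\<^sup>2 * (\<Sum>k\<le>N. 1 / real (t k)) + \<alpha> * \<sigma> * (\<Sum>k\<le>N. 1 / sqrt (real (t k)))"
    by linarith
  \<comment> \<open>Squaring the lower bound on \<open>h\<close> makes the common denominator of the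
    rate positive.\<close>
  have h_lower: "6 * \<rho> < L1 * h\<^sup>2 * lmin * lmax * \<kappa>"
  proof -
    have pos: "0 < L1 * \<kappa> * lmax * lmin" using L1_pos kappa1 bd.lmin_pos bd.lmax_pos by simp
    have "(sqrt (6 * \<rho> / (L1 * \<kappa> * lmax * lmin)))\<^sup>2 < h\<^sup>2"
      using h(2) rho(1) pos by (intro power_strict_mono) auto
    then have "6 * \<rho> / (L1 * \<kappa> * lmax * lmin) < h\<^sup>2" using rho(1) pos by simp
    then show ?thesis using pos by (simp add: pos_divide_less_eq mult_ac)
  qed
  have total': "c0 * (\<Sum>k\<le>N. \<integral>\<omega>. (norm (s k \<omega>))\<^sup>2 \<partial>M)
      \<le> (norm (z0 - zstar))\<^sup>2
        + (real N + 1) * (Dz / (L1 * lmax) * (\<mu> * L1 * sqrt d) + 2 * \<rho> * \<kappa> / (L1 * lmax) * (\<mu> * L1 * sqrt d)\<^sup>2)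
        + (2 * \<rho> * \<kappa> / (L1 * lmax) + 2 / (L1\<^sup>2 * \<kappa> * lmax)) * \<sigma>\<^sup>2 * (\<Sum>k\<le>N. 1 / real (t k))
        + Dz / (L1 * lmax) * \<sigma> * (\<Sum>k\<le>N. 1 / sqrt (real (t k)))"
    using total by (simp add: \<alpha>_def \<beta>_def \<gamma>_def b_def)
  have T1: "0 \<le> (\<Sum>k\<le>N. 1 / real (t k))" by (intro sum_nonneg) simp
  have "1 \<le> CARD('n) + CARD('m)" using zero_less_card_finite[where 'a = 'n] by linarith
  then have d1: "1 \<le> d" unfolding d by (simp only: real_of_nat_ge_one_iff)
  show ?thesis
    by (rule rate_arithmetic[OF L1_pos bd.lmin_pos bd.lmax_pos kappa1 h(1) _ rho(1) Dz0 mu_pos sigma_nonneg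
          T1 d1 h_lower total'[unfolded c0_def]]) simp
qed

end
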